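(* Let $\Delta, L_1, \sigma_1 > 0$, let $0<\epsilon < \frac14$, and let $0\le B_1 \le O(1)$. Then there exist a function $F \in \mathcal{F}_1(\Delta, L_1)$ (on $\mathbb{R}^d$ for some dimension $d$) and a biased and stochastic first-order oracle $(O_F^1, P_z) \in \mathcal{O}_1(F, \sigma_1, B_1)$ such that, for any first-order zero-respecting algorithm interacting with this oracle, the minimum number of oracle queries needed to obtain, with constant probability, a point $x$ with $\|\nabla F(x)\| \le (\epsilon + B_1^2)^{1/2}$ is bounded below by $$\Omega\left(\frac{\Delta L_1}{\epsilon + B_1^2} + \frac{\Delta L_1 \sigma_1^2}{\epsilon^2 + B_1^4}\right).$$
   Context: Function class. $\mathcal{F}_1(\Delta, L_1)$ is the set of differentiable $F:\mathbb{R}^d\to\mathbb{R}$ with $\|\nabla F(x)-\nabla F(y)\|\le L_1\|x-y\|$ for all $x,y\in\mathbb{R}^d$ and $F(0)-\inf_{x}F(x)\le\Delta$. Here $\|\cdot\|$ is the Euclidean norm. Oracles. $\mathcal{O}_1(F,\sigma_1,B_1)$ is the set of pairs $(O_F^1,P_z)$, where $P_z$ is a distribution on a measurable set $\mathcal{Z}$ and, at a query point $x$, a fresh $z\sim P_z$ is drawn and the oracle returns the gradient estimate $\tilde\nabla F(x,z,b_1)=\nabla F(x)+\xi_1(x,z)+b_1(x)$, with $\mathbb{E}_{z\sim P_z}[\xi_1(x,z)]=0$, $\mathbb{E}\|\xi_1(x,z)\|^2\le\sigma_1^2$ and $\|b_1(x)\|\le B_1$ for all $x$. Zero-respecting algorithms.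 For a vector $v\in\mathbb{R}^d$ let $\mathrm{supp}(v)=\{i\in\{1,\dots,d\}: v_i\ne0\}$. An algorithm interacting with the oracle is (first-order) zero-respecting if, for any function and any such oracle, its query points $x^{(t)}$ satisfy $\mathrm{supp}(x^{(t)})\subseteq\bigcup_{i<t}\mathrm{supp}\big(\tilde\nabla F(x^{(i)},z^{(i)},b_1)\big)$ for all $t\in\mathbb{N}$, where $z^{(i)}$ is the random draw used at query $i$. Asymptotic conventions. "$B_1\le O(1)$" means that $B_1$ is bounded by an absolute constant; "constant probability" means probability at least some fixed positive absolute constant; $\Omega(\cdot)$ hides positive absolute constants.
   Formalization: The formal theorem adds the assumption ε + B₁² < 2ΔL₁; without it the starting point 0 already satisfies ‖∇F(0)‖ ≤ (ε + B₁²)^{1/2} for every F in the class, so no query is needed and the claimed bound is false. *)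

theory Defs
  imports "HOL-Probability.Probability"
begin

text \<open>
  The dimension is existentially quantified in the result, so it cannot be a type.  Following the
  library's \<^const>\<open>Euclidean_space\<close>, the space of dimension d is the set of sequences
  vanishing from index d on; coordinates are numbered from 0.
\<close>

definition Rd :: "nat \<Rightarrow> (nat \<Rightarrow> real) set" where
  "Rd d = topspace (Euclidean_space d)"

definition enorm :: "nat \<Rightarrow> (nat \<Rightarrow> real) \<Rightarrow> real" where
  "enorm d v = L2_set v {..<d}"

definition edist :: "nat \<Rightarrow> (nat \<Rightarrow> real) \<Rightarrow> (nat \<Rightarrow> real) \<Rightarrow> real" where
  "edist d x y = enorm d (\<lambda>i. x i - y i)"

text \<open>
  The Borel algebra below comes from the product topology on sequences, whose trace on
  \<^term>\<open>Rd d\<close> is the Euclidean topology.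
\<close>

definition borel_Rd :: "nat \<Rightarrow> (nat \<Rightarrow> real) measure" where
  "borel_Rd d = restrict_space borel (Rd d)"

definition supp :: "nat \<Rightarrow> (nat \<Rightarrow> real) \<Rightarrow> nat set" where
  "supp d v = {i \<in> {..<d}. v i \<noteq> 0}"

definition has_grad :: "nat \<Rightarrow> ((nat \<Rightarrow> real) \<Rightarrow> real) \<Rightarrow> (nat \<Rightarrow> real) \<Rightarrow> (nat \<Rightarrow> real) \<Rightarrow> bool" where
  "has_grad d F x v \<longleftrightarrow> v \<in> Rd d \<and>
     (\<forall>e>0. \<exists>\<delta>>0. \<forall>y\<in>Rd d. edist d y x < \<delta> \<longrightarrow>
        \<bar>F y - F x - (\<Sum>i<d. v i * (y i - x i))\<bar> \<le> e * edist d y x)"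

definition grad :: "nat \<Rightarrow> ((nat \<Rightarrow> real) \<Rightarrow> real) \<Rightarrow> (nat \<Rightarrow> real) \<Rightarrow> (nat \<Rightarrow> real)" where
  "grad d F x = (THE v. has_grad d F x v)"

definition smooth_class :: "nat \<Rightarrow> real \<Rightarrow> real \<Rightarrow> ((nat \<Rightarrow> real) \<Rightarrow> real) set" where
  "smooth_class d \<Delta> L = {F.
     (\<forall>x\<in>Rd d. \<exists>v. has_grad d F x v) \<and>
     (\<forall>x\<in>Rd d. \<forall>y\<in>Rd d. edist d (grad d F x) (grad d F y) \<le> L * edist d x y) \<and>
     bdd_below (F ` Rd d) \<and>
     F (\<lambda>_. 0) - (INF x\<in>Rd d. F x) \<le> \<Delta>}"

text \<open>
  An oracle is a pair (g, P) of a gradient estimator and a sampling distribution P on the set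
  \<^term>\<open>space P\<close>.  The joint measurability makes the iterates of a measurable algorithm
  random variables.
\<close>

definition oracle_class ::
  "nat \<Rightarrow> ((nat \<Rightarrow> real) \<Rightarrow> real) \<Rightarrow> real \<Rightarrow> real \<Rightarrow>
   (((nat \<Rightarrow> real) \<Rightarrow> 'z \<Rightarrow> (nat \<Rightarrow> real)) \<times> 'z measure) set" where
  "oracle_class d F \<sigma> B = {(g, P). prob_space P \<and>
     (\<lambda>(x, z). g x z) \<in> borel_Rd d \<Otimes>\<^sub>M P \<rightarrow>\<^sub>M borel_Rd d \<and>
     (\<exists>\<xi> b.
        (\<forall>x\<in>Rd d. \<forall>z\<in>space P. \<forall>i<d. g x z i = grad d F x i + \<xi> x z i + b x i) \<and>
        (\<forall>x\<in>Rd d. \<forall>i<d. integrable P (\<lambda>z. \<xi> x z i) \<and> (\<integral>z. \<xi> x z i \<partial>P) = 0) \<and>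
        (\<forall>x\<in>Rd d. integrable P (\<lambda>z. (enorm d (\<xi> x z))\<^sup>2) \<and>
                   (\<integral>z. (enorm d (\<xi> x z))\<^sup>2 \<partial>P) \<le> \<sigma>\<^sup>2) \<and>
        (\<forall>x\<in>Rd d. enorm d (b x) \<le> B))}"

text \<open>
  A (possibly randomized) algorithm consists of the distribution S of its internal seed and of
  maps A t, which compute query point number t from the seed and the first t oracle answers.
  Deterministic algorithms are those whose maps ignore the seed.
\<close>

type_synonym 'r alg = "nat \<Rightarrow> 'r \<Rightarrow> (nat \<Rightarrow> nat \<Rightarrow> real) \<Rightarrow> (nat \<Rightarrow> real)"

definition algorithm :: "nat \<Rightarrow> 'r measure \<Rightarrow> 'r alg \<Rightarrow> bool" where
  "algorithm d S A \<longleftrightarrow> prob_space S \<and>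
     (\<forall>t. (\<lambda>(r, h). A t r h) \<in> S \<Otimes>\<^sub>M (\<Pi>\<^sub>M i\<in>{..<t}. borel_Rd d) \<rightarrow>\<^sub>M borel_Rd d)"

fun query :: "'r alg \<Rightarrow> ((nat \<Rightarrow> real) \<Rightarrow> 'z \<Rightarrow> (nat \<Rightarrow> real)) \<Rightarrow> 'r \<Rightarrow> (nat \<Rightarrow> 'z) \<Rightarrow> nat \<Rightarrow> (nat \<Rightarrow> real)" where
  "query A g r z t = A t r (\<lambda>i. if i \<in> {..<t} then g (query A g r z i) (z i) else undefined)"

declare query.simps [simp del]

definition run_space :: "'r measure \<Rightarrow> 'z measure \<Rightarrow> ('r \<times> (nat \<Rightarrow> 'z)) measure" where
  "run_space S P = S \<Otimes>\<^sub>M (\<Pi>\<^sub>M i\<in>UNIV. P)"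

text \<open>
  The sample set of the oracles is a subset of the reals here, since a definition cannot quantify
  over types.
\<close>

definition zero_respecting ::
  "nat \<Rightarrow> real \<Rightarrow> real \<Rightarrow> real \<Rightarrow> real \<Rightarrow> 'r measure \<Rightarrow> 'r alg \<Rightarrow> bool" where
  "zero_respecting d \<Delta> L \<sigma> B S A \<longleftrightarrow>
     (\<forall>F \<in> smooth_class d \<Delta> L.
      \<forall>(g, P) \<in> (oracle_class d F \<sigma> B ::
                   (((nat \<Rightarrow> real) \<Rightarrow> real \<Rightarrow> (nat \<Rightarrow> real)) \<times> real measure) set).
        AE (r, z) in run_space S P. \<forall>t.
          supp d (query A g r z t) \<subseteq> (\<Union>i<t. supp d (g (query A g r z i) (z i))))"

text \<open>
  After N oracle queries the algorithm has determined the points number 0, ..., N, the last of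
  them from all N answers.  The infimum of the empty set is \<open>\<infinity>\<close>: this is the value
  if the required probability is never reached.
\<close>

definition query_complexity ::
  "nat \<Rightarrow> ((nat \<Rightarrow> real) \<Rightarrow> real) \<Rightarrow> ((nat \<Rightarrow> real) \<Rightarrow> 'z \<Rightarrow> (nat \<Rightarrow> real)) \<Rightarrow> 'z measure \<Rightarrow>
   'r measure \<Rightarrow> 'r alg \<Rightarrow> real \<Rightarrow> real \<Rightarrow> ereal" where
  "query_complexity d F g P S A \<tau> p =
     Inf {ereal (real N) | N.
       p \<le> measure (run_space S P)
             {(r, z) \<in> space (run_space S P). \<exists>t\<le>N. enorm d (grad d F (query A g r z t)) \<le> \<tau>}}"

end

theory Submission
  imports Defs
begin

text \<open>
  Hard instance: a chain in which coordinate \<open>i\<close> of the gradient vanishes until coordinate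
  \<open>i - 1\<close> of the query point is nonzero, and in which the gradient stays large until the last
  coordinate is nonzero; rescaled to fit \<open>\<Delta>\<close> and \<open>L\<^sub>1\<close>, its length is of order
  \<open>\<Delta> L\<^sub>1 / (\<epsilon> + B\<^sub>1\<^sup>2)\<close>.  The unbiased oracle shows the one new coordinate of the gradient
  only with probability \<open>q\<close> (scaled by \<open>1 / q\<close>); the variance budget allows \<open>q\<close> of order
  \<open>(\<epsilon> + B\<^sub>1\<^sup>2) / (\<epsilon> + B\<^sub>1\<^sup>2 + \<sigma>\<^sub>1\<^sup>2)\<close>.  A zero-respecting algorithm gains at most one coordinate per
  successful coin flip, so Markov's inequality bounds the number of queries below by \<open>p d / q\<close>.
  When the chain would be shorter than 1, the one-dimensional quadratic with
  \<open>\<bar>F' 0\<bar> = sqrt (2 \<Delta> L\<^sub>1)\<close> is used.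
\<close>

section \<open>Gradients\<close>

lemma Rd_iff: "x \<in> Rd d \<longleftrightarrow> (\<forall>i\<ge>d. x i = 0)"
  by (simp add: Rd_def topspace_Euclidean_space)

lemma enorm_nonneg [simp]: "0 \<le> enorm d v"
  by (simp add: enorm_def)

lemma enorm_sq: "(enorm d v)\<^sup>2 = (\<Sum>i<d. (v i)\<^sup>2)"
  by (simp add: enorm_def L2_set_def sum_nonneg)

lemma abs_le_enorm: "i < d \<Longrightarrow> \<bar>v i\<bar> \<le> enorm d v"
  unfolding enorm_def L2_set_def
  by (rule real_le_rsqrt) (simp add: member_le_sum[of i "{..<d}" "\<lambda>i. (v i)\<^sup>2"])

lemma enorm_scale: "enorm d (\<lambda>i. c * v i) = \<bar>c\<bar> * enorm d v"
  by (simp add: enorm_def L2_set_def power_mult_distrib real_sqrt_mult flip: sum_distrib_left)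

lemma edist_nonneg [simp]: "0 \<le> edist d x y"
  by (simp add: edist_def)

text \<open>Makes the \<open>THE\<close> in \<open>grad\<close> well defined. Both expansions are
  tested along the direction \<open>v - w\<close>: their linear parts differ by
  \<open>s * n\<^sup>2\<close>, while the two error terms together allow only half of that.\<close>

lemma has_grad_unique:
  assumes x: "x \<in> Rd d" and v: "has_grad d F x v" and w: "has_grad d F x w"
  shows "v = w"
proof -
  define u where "u = (\<lambda>i. v i - w i)"
  define n where "n = enorm d u"
  have "n = 0"
  proof (rule ccontr)
    assume "n \<noteq> 0"
    then have n: "n > 0" by (simp add: n_def order_less_le)
    obtain \<delta> where \<delta>: "\<delta> > 0" "\<And>y. y \<in> Rd d \<Longrightarrow> edist d y x < \<delta> \<Longrightarrow>
        \<bar>F y - F x - (\<Sum>i<d. v i * (y i - x i))\<bar> \<le> n / 4 * edist d y x"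
      using v n unfolding has_grad_def by (metis divide_pos_pos zero_less_numeral)
    obtain \<delta>' where \<delta>': "\<delta>' > 0" "\<And>y. y \<in> Rd d \<Longrightarrow> edist d y x < \<delta>' \<Longrightarrow>
        \<bar>F y - F x - (\<Sum>i<d. w i * (y i - x i))\<bar> \<le> n / 4 * edist d y x"
      using w n unfolding has_grad_def by (metis divide_pos_pos zero_less_numeral)
    \<comment> \<open>Puts \<open>y\<close> at distance \<open>min \<delta> \<delta>' / 2\<close>
      from \<open>x\<close>, inside both neighbourhoods.\<close>
    define s where "s = min \<delta> \<delta>' / (2 * n)"
    define y where "y = (\<lambda>i. x i + s * u i)"
    have s: "s > 0" using \<delta>(1) \<delta>'(1) n by (simp add: s_def)
    have yx: "y i - x i = s * u i" for i by (simp add: y_def)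
    have d: "edist d y x = s * n"
      using s by (simp add: edist_def yx enorm_scale n_def)
    have "y \<in> Rd d" using x v w by (simp add: Rd_iff y_def u_def has_grad_def)
    moreover have "edist d y x < \<delta>" "edist d y x < \<delta>'"
      using \<delta>(1) \<delta>'(1) n unfolding d s_def by (auto simp: min_def)
    ultimately have 1: "\<bar>F y - F x - (\<Sum>i<d. v i * (y i - x i))\<bar> \<le> n / 4 * (s * n)"
      and 2: "\<bar>F y - F x - (\<Sum>i<d. w i * (y i - x i))\<bar> \<le> n / 4 * (s * n)"
      using \<delta>(2)[of y] \<delta>'(2)[of y] d by metis+
    have "(\<Sum>i<d. v i * (y i - x i)) - (\<Sum>i<d. w i * (y i - x i)) = s * (\<Sum>i<d. (u i)\<^sup>2)"
      by (simp add: yx sum_distrib_left u_def power2_eq_square algebra_simps flip: sum_subtractf)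
    also have "\<dots> = s * n\<^sup>2" by (simp add: n_def enorm_sq)
    moreover have "n / 4 * (s * n) = s * n\<^sup>2 / 4" by (simp add: power2_eq_square)
    ultimately have "s * n\<^sup>2 \<le> s * n\<^sup>2 / 2"
      using 1 2 unfolding abs_le_iff by linarith
    moreover have "s * n\<^sup>2 > 0" using s n by simp
    ultimately show False by simp
  qed
  then have "v i = w i" if "i < d" for i
    using abs_le_enorm[OF that, of u] by (simp add: n_def u_def)
  moreover have "v i = w i" if "i \<ge> d" for i
    using v w that by (simp add: has_grad_def Rd_iff)
  ultimately show ?thesis by (metis ext not_le)
qed

lemma has_grad_quadratic_error:
  assumes v: "v \<in> Rd d" and K: "0 \<le> K"
    and bound: "\<And>y. y \<in> Rd d \<Longrightarrow>
      \<bar>F y - F x - (\<Sum>i<d. v i * (y i - x i))\<bar> \<le> K * (\<Sum>i<d. (y i - x i)\<^sup>2)"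
  shows "has_grad d F x v"
  unfolding has_grad_def
proof (intro conjI allI impI)
  show "v \<in> Rd d" by (fact v)
  fix e :: real assume e: "e > 0"
  show "\<exists>\<delta>>0. \<forall>y\<in>Rd d. edist d y x < \<delta> \<longrightarrow>
        \<bar>F y - F x - (\<Sum>i<d. v i * (y i - x i))\<bar> \<le> e * edist d y x"
  \<comment> \<open>\<open>K + 1\<close> instead of \<open>K\<close> keeps the radius meaningful for
    \<open>K = 0\<close>.\<close>
  proof (intro exI[of _ "e / (K + 1)"] conjI ballI impI)
    show "e / (K + 1) > 0" using e K by simp
    fix y assume y: "y \<in> Rd d" and "edist d y x < e / (K + 1)"
    then have "(K + 1) * edist d y x \<le> e"
      using K by (simp add: field_simps)
    then have "K * edist d y x \<le> e"
      using edist_nonneg[of d y x] unfolding distrib_right by linarith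
    then have "K * edist d y x * edist d y x \<le> e * edist d y x"
      by (intro mult_right_mono) simp_all
    also have "K * edist d y x * edist d y x = K * (\<Sum>i<d. (y i - x i)\<^sup>2)"
      using enorm_sq[of d "\<lambda>i. y i - x i"] by (simp add: edist_def power2_eq_square)
    finally show "\<bar>F y - F x - (\<Sum>i<d. v i * (y i - x i))\<bar> \<le> e * edist d y x"
      using bound[OF y] by linarith
  qed
qed

section \<open>Zero-chains with a randomly revealed coordinate\<close>

lemma measurable_borel_Rd_component [measurable]:
  "(\<lambda>x. x i) \<in> borel_measurable (borel_Rd d)"
  unfolding borel_Rd_def
  by (intro measurable_restrict_space1 borel_measurable_continuous_onI
      continuous_on_product_coordinates)

lemma measurable_borel_RdI:
  assumes "\<And>i. (\<lambda>w. f w i) \<in> borel_measurable M" and "\<And>w. f w \<in> Rd d"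
  shows "f \<in> M \<rightarrow>\<^sub>M borel_Rd d"
  unfolding borel_Rd_def
  by (rule measurable_restrict_space2)
    (use assms in \<open>auto intro!: measurable_coordinatewise_then_product\<close>)

lemma space_borel_Rd: "space (borel_Rd d) = Rd d"
  by (simp add: borel_Rd_def space_restrict_space)

text \<open>A Bernoulli variable with values 0 and 1 in the reals, because
  \<open>zero_respecting\<close> speaks about oracles with real samples; 1 means success.\<close>

definition coin :: "real \<Rightarrow> real measure" where
  "coin q = measure_pmf (map_pmf of_bool (bernoulli_pmf q))"

lemma prob_space_coin: "prob_space (coin q)"
  by (simp add: coin_def prob_space_measure_pmf)

lemma space_coin [simp]: "space (coin q) = UNIV"
  by (simp add: coin_def)

lemma sets_coin [simp, measurable_cong]: "sets (coin q) = sets (count_space UNIV)"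
  by (simp add: coin_def)

lemma integrable_coin [simp]: "integrable (coin q) (f :: real \<Rightarrow> real)"
  unfolding coin_def by (rule integrable_measure_pmf_finite) simp

lemma integral_coin:
  fixes f :: "real \<Rightarrow> real"
  assumes "0 \<le> q" "q \<le> 1"
  shows "(\<integral>z. f z \<partial>coin q) = f 1 * q + f 0 * (1 - q)"
  using assms by (simp add: coin_def)

lemma prob_coin:
  assumes "0 \<le> q" "q \<le> 1"
  shows "measure (coin q) {1} = q"
proof -
  have "of_bool -` {1 :: real} = {True}" by auto
  then show ?thesis using assms by (simp add: coin_def measure_pmf_single pmf_map)
qed

definition successes :: "nat \<Rightarrow> (nat \<Rightarrow> real) \<Rightarrow> nat" where
  "successes t z = card {i\<in>{..<t}. z i = 1}"

text \<open>Each draw succeeds with probability \<open>q\<close>, so linearity of expectation gives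
  \<open>N * q\<close> expected successes, and Markov's inequality bounds the chance of seeing
  \<open>d\<close> of them.\<close>

lemma prob_successes_le:
  assumes S: "prob_space S" and q: "0 \<le> q" "q \<le> 1" and d: "0 < d"
  defines "M \<equiv> run_space S (coin q)"
  shows "{w \<in> space M. d \<le> successes N (snd w)} \<in> sets M"
    and "measure M {w \<in> space M. d \<le> successes N (snd w)} \<le> real N * q / real d"
proof -
  let ?\<Pi> = "\<Pi>\<^sub>M i\<in>(UNIV :: nat set). coin q"
  interpret S: prob_space S by fact
  interpret \<Pi>: prob_space ?\<Pi> by (intro prob_space_PiM prob_space_coin)
  interpret SP: pair_prob_space S ?\<Pi> ..
  have M: "M = S \<Otimes>\<^sub>M ?\<Pi>" by (simp add: M_def run_space_def)
  interpret M: prob_space M unfolding M by (rule SP.prob_space_axioms)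
  define E where "E = (\<lambda>i. {w \<in> space M. snd w i = 1})"
  define u where "u = (\<lambda>w. \<Sum>i<N. indicator (E i) w :: real)"
  have E_eq: "E i = space S \<times> {z \<in> space ?\<Pi>. z i = 1}" for i
    by (auto simp: E_def M space_pair_measure)
  have comp: "{z \<in> space ?\<Pi>. z i = 1} \<in> sets ?\<Pi>" for i
  proof -
    have "(\<lambda>z. z i) -` {1} \<inter> space ?\<Pi> \<in> sets ?\<Pi>"
      by (rule measurable_sets[OF measurable_component_singleton]) auto
    also have "(\<lambda>z. z i) -` {1} \<inter> space ?\<Pi> = {z \<in> space ?\<Pi>. z i = 1}" by auto
    finally show ?thesis .
  qed
  have E_sets [measurable]: "E i \<in> sets M" for i
    unfolding E_eq M using comp by auto
  have "measure ?\<Pi> {z \<in> space ?\<Pi>. z i = 1} = q" for i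
  proof -
    have "q = measure (distr ?\<Pi> (coin q) (\<lambda>z. z i)) {1}"
      using q distr_PiM_component[of UNIV "\<lambda>_. coin q" i] by (simp add: prob_coin prob_space_coin)
    also have "\<dots> = measure ?\<Pi> ((\<lambda>z. z i) -` {1} \<inter> space ?\<Pi>)"
      by (rule measure_distr) (auto intro: measurable_component_singleton)
    also have "(\<lambda>z. z i) -` {1} \<inter> space ?\<Pi> = {z \<in> space ?\<Pi>. z i = 1}" by auto
    finally show ?thesis by simp
  qed
  then have E_prob: "measure M (E i) = q" for i
    unfolding E_eq M using \<Pi>.emeasure_pair_measure_Times[OF sets.top comp, of S i]
    by (simp add: measure_def S.emeasure_space_1)
  have succ: "real (successes N (snd w)) = u w" if "w \<in> space M" for w
  proof -
    have "u w = (\<Sum>i<N. if snd w i = 1 then 1 else 0)"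
      using that unfolding u_def E_def by (intro sum.cong) (auto simp: indicator_def)
    also have "\<dots> = real (successes N (snd w))"
      by (simp add: successes_def sum.inter_filter[symmetric])
    finally show ?thesis by simp
  qed
  have set_eq: "{w \<in> space M. d \<le> successes N (snd w)} = {w \<in> space M. u w \<ge> real d}"
    using succ by (metis (no_types, lifting) of_nat_le_iff)
  have int: "integrable M u"
    unfolding u_def by (intro Bochner_Integration.integrable_sum integrable_real_indicator)
      (auto simp: less_top[symmetric])
  then have [measurable]: "u \<in> borel_measurable M" by simp
  show "{w \<in> space M. d \<le> successes N (snd w)} \<in> sets M"
    unfolding set_eq by measurable
  have "measure M {w \<in> space M. u w \<ge> real d} \<le> (\<integral>w. u w \<partial>M) / real d"
    using d int by (intro integral_Markov_inequality_measure[where A = "{}"]) (auto simp: u_def sum_nonneg)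
  also have "(\<integral>w. u w \<partial>M) = real N * q"
    unfolding u_def by (subst Bochner_Integration.integral_sum)
      (auto simp: E_prob less_top[symmetric] intro!: integrable_real_indicator)
  finally show "measure M {w \<in> space M. d \<le> successes N (snd w)} \<le> real N * q / real d"
    unfolding set_eq .
qed

section \<open>Abstract zero-chains and their oracle\<close>

definition vanishes_from :: "nat \<Rightarrow> (nat \<Rightarrow> real) \<Rightarrow> bool" where
  "vanishes_from k x \<longleftrightarrow> (\<forall>j\<ge>k. x j = 0)"

text \<open>The interface between the probabilistic argument and the two concrete hard functions.
  \<open>G\<close> is the gradient of \<open>F\<close>, certified by a quadratic Taylor error with
  constant \<open>K\<close>; \<open>M\<close> bounds the one coordinate that can be newly discovered
  and so fixes the price of hiding it; \<open>\<tau>\<close> is the accuracy not met while the last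
  coordinate is still 0.\<close>

locale zero_chain =
  fixes d :: nat and F :: "(nat \<Rightarrow> real) \<Rightarrow> real" and G :: "(nat \<Rightarrow> real) \<Rightarrow> nat \<Rightarrow> real"
    and K L \<Delta> M \<tau> :: real
  assumes dim_pos: "0 < d" and K_nonneg: "0 \<le> K" and M_pos: "0 < M"
    and G_eq_0: "\<And>x i. d \<le> i \<Longrightarrow> G x i = 0"
    and G_measurable [measurable]: "\<And>i. (\<lambda>x. G x i) \<in> borel_measurable (borel_Rd d)"
    and G_grad: "\<And>x y. x \<in> Rd d \<Longrightarrow> y \<in> Rd d \<Longrightarrow>
      \<bar>F y - F x - (\<Sum>i<d. G x i * (y i - x i))\<bar> \<le> K * (\<Sum>i<d. (y i - x i)\<^sup>2)"
    and G_lipschitz: "\<And>x y. x \<in> Rd d \<Longrightarrow> y \<in> Rd d \<Longrightarrow> edist d (G x) (G y) \<le> L * edist d x y"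
    and F_ge: "\<And>x. x \<in> Rd d \<Longrightarrow> F (\<lambda>_. 0) - \<Delta> \<le> F x"
    and G_chain: "\<And>x k i. x \<in> Rd d \<Longrightarrow> vanishes_from k x \<Longrightarrow> k < i \<Longrightarrow> G x i = 0"
    and G_le: "\<And>x k. x \<in> Rd d \<Longrightarrow> vanishes_from k x \<Longrightarrow> \<bar>G x k\<bar> \<le> M"
    and G_large: "\<And>x k. x \<in> Rd d \<Longrightarrow> vanishes_from k x \<Longrightarrow> k < d \<Longrightarrow> \<tau> < enorm d (G x)"
begin

lemma G_Rd: "G x \<in> Rd d"
  by (simp add: Rd_iff G_eq_0)

lemma has_grad_F: "x \<in> Rd d \<Longrightarrow> has_grad d F x (G x)"
  by (rule has_grad_quadratic_error[OF G_Rd K_nonneg G_grad])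

lemma grad_F: "x \<in> Rd d \<Longrightarrow> grad d F x = G x"
  unfolding grad_def using has_grad_F has_grad_unique by (metis the_equality)

lemma F_smooth_class: "F \<in> smooth_class d \<Delta> L"
proof -
  have "bdd_below (F ` Rd d)"
    using F_ge by (auto intro!: bdd_belowI2)
  moreover have "F (\<lambda>_. 0) - \<Delta> \<le> (INF x\<in>Rd d. F x)"
    using F_ge by (intro cINF_greatest) (auto simp: Rd_iff)
  ultimately show ?thesis
    using has_grad_F G_lipschitz by (auto simp: smooth_class_def grad_F)
qed

text \<open>The condition \<open>vanishes_from i x\<close> selects every index past the support of
  \<open>x\<close>, but by \<open>G_chain\<close> at most the first of these carries a nonzero
  entry. Coordinates before it are returned exactly.\<close>

definition reveal :: "real \<Rightarrow> (nat \<Rightarrow> real) \<Rightarrow> real \<Rightarrow> nat \<Rightarrow> real" where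
  "reveal q x z = (\<lambda>i. if vanishes_from i x then (if z = 1 then G x i / q else 0) else G x i)"

lemma reveal_Rd: "reveal q x z \<in> Rd d"
  by (simp add: reveal_def Rd_iff G_eq_0)

lemma reveal_measurable:
  "(\<lambda>(x, z). reveal q x z) \<in> borel_Rd d \<Otimes>\<^sub>M coin q' \<rightarrow>\<^sub>M borel_Rd d"
proof (rule measurable_borel_RdI)
  fix i
  show "(\<lambda>w. (case w of (x, z) \<Rightarrow> reveal q x z) i) \<in> borel_measurable (borel_Rd d \<Otimes>\<^sub>M coin q')"
    unfolding reveal_def vanishes_from_def split_beta by measurable
qed (simp add: reveal_Rd split_beta)

text \<open>Only the least index \<open>k\<close> with \<open>vanishes_from k x\<close> contributes,
  as \<open>G_chain\<close> kills all later ones. Hence the noise has a variance bound free of the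
  dimension.\<close>

lemma sum_frontier_le:
  assumes x: "x \<in> Rd d"
  shows "(\<Sum>i<d. (if vanishes_from i x then G x i else 0)\<^sup>2) \<le> M\<^sup>2"
proof -
  define k where "k = (LEAST k. vanishes_from k x)"
  have "vanishes_from d x" using x by (simp add: Rd_iff vanishes_from_def)
  then have k: "vanishes_from k x" unfolding k_def by (rule LeastI)
  have Gk: "(G x k)\<^sup>2 \<le> M\<^sup>2"
    using G_le[OF x k] M_pos by (intro power2_le_iff_abs_le[THEN iffD2]) simp_all
  have "G x i = 0" if "vanishes_from i x" "i \<noteq> k" for i
  proof -
    have "k < i" using that unfolding k_def by (metis Least_le le_neq_implies_less)
    then show ?thesis by (rule G_chain[OF x k])
  qed
  then have "(if vanishes_from i x then G x i else 0)\<^sup>2 \<le> (if i = k then M\<^sup>2 else 0)" for i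
    using Gk by (cases "i = k"; cases "vanishes_from i x") simp_all
  then have "(\<Sum>i<d. (if vanishes_from i x then G x i else 0)\<^sup>2) \<le> (\<Sum>i<d. if i = k then M\<^sup>2 else 0)"
    by (rule sum_mono)
  also have "\<dots> \<le> M\<^sup>2" by simp
  finally show ?thesis .
qed

lemma reveal_in_class:
  assumes q: "0 < q" "q \<le> 1" and B: "0 \<le> B" and var: "M\<^sup>2 * (1 - q) / q \<le> \<sigma>\<^sup>2"
  shows "(reveal q, coin q) \<in> oracle_class d F \<sigma> B"
proof -
  \<comment> \<open>The noise is this scalar times the hidden part \<open>v x\<close> of the
    gradient. It has mean 0 and variance \<open>(1 - q) / q\<close>.\<close>
  define \<zeta> where "\<zeta> = (\<lambda>z :: real. (if z = 1 then 1 / q else 0) - 1)"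
  define v where "v = (\<lambda>x i. if vanishes_from i x then G x i else 0)"
  define \<xi> where "\<xi> = (\<lambda>x z i. \<zeta> z * v x i)"
  have "reveal q x z i = grad d F x i + \<xi> x z i + 0" if "x \<in> Rd d" for x z i
    using that by (simp add: reveal_def grad_F \<xi>_def \<zeta>_def v_def algebra_simps)
  moreover have "(\<integral>z. \<xi> x z i \<partial>coin q) = 0" for x i
    using q by (subst integral_coin) (simp_all add: \<xi>_def \<zeta>_def field_simps)
  moreover have "(\<integral>z. (enorm d (\<xi> x z))\<^sup>2 \<partial>coin q) \<le> \<sigma>\<^sup>2" if x: "x \<in> Rd d" for x
  proof -
    have "(\<integral>z. (enorm d (\<xi> x z))\<^sup>2 \<partial>coin q) = (\<integral>z. (\<zeta> z)\<^sup>2 * (enorm d (v x))\<^sup>2 \<partial>coin q)"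
      by (simp add: \<xi>_def enorm_scale power_mult_distrib)
    also have "\<dots> = (enorm d (v x))\<^sup>2 * ((1 - q) / q)"
      using q by (subst integral_coin) (simp_all add: \<zeta>_def field_simps power2_eq_square)
    also have "\<dots> \<le> M\<^sup>2 * ((1 - q) / q)"
      using sum_frontier_le[OF x] q by (intro mult_right_mono) (simp_all add: enorm_sq v_def)
    finally show ?thesis using var by simp
  qed
  \<comment> \<open>The bias of the oracle is chosen to be zero, which fits every budget
    \<open>B \<ge> 0\<close>.\<close>
  moreover have "enorm d (\<lambda>_. 0) \<le> B"
    using B by (simp add: enorm_def L2_set_def)
  ultimately show ?thesis
    unfolding oracle_class_def
    by (auto simp: prob_space_coin reveal_measurable
        intro!: exI[of _ \<xi>] exI[of _ "\<lambda>_ _. 0 :: real"])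
qed

section \<open>Progress of a zero-respecting algorithm\<close>

lemma query_Rd:
  assumes "algorithm d S A" and "r \<in> space S"
  shows "query A (reveal q) r z t \<in> Rd d"
proof -
  \<comment> \<open>The default \<open>undefined\<close> makes the history extensional, as
    membership in the space of the product measure demands.\<close>
  define h where "h = (\<lambda>i. if i \<in> {..<t} then reveal q (query A (reveal q) r z i) (z i) else undefined)"
  have "h \<in> space (\<Pi>\<^sub>M i\<in>{..<t}. borel_Rd d)"
    by (auto simp: h_def space_PiM PiE_def extensional_def space_borel_Rd reveal_Rd)
  then have "(r, h) \<in> space (S \<Otimes>\<^sub>M (\<Pi>\<^sub>M i\<in>{..<t}. borel_Rd d))"
    using assms(2) by (simp add: space_pair_measure)
  moreover have "(\<lambda>(r, h). A t r h) \<in> S \<Otimes>\<^sub>M (\<Pi>\<^sub>M i\<in>{..<t}. borel_Rd d) \<rightarrow>\<^sub>M borel_Rd d"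
    using assms(1) by (simp add: algorithm_def)
  ultimately have "A t r h \<in> Rd d"
    using measurable_space[of "\<lambda>(r, h). A t r h"] by (fastforce simp: space_borel_Rd)
  then show ?thesis by (simp add: query.simps[of A _ r z t] h_def)
qed

text \<open>Each successful draw uncovers at most one new coordinate. In the strong induction, a
  nonzero coordinate that is too far out must stem from some earlier answer, and that answer must
  itself have been a success that was already counted.\<close>

lemma query_vanishes_from:
  assumes Rd: "\<And>t. query A (reveal q) r z t \<in> Rd d"
    and zr: "\<And>t. supp d (query A (reveal q) r z t)
      \<subseteq> (\<Union>i<t. supp d (reveal q (query A (reveal q) r z i) (z i)))"
  shows "vanishes_from (successes t z) (query A (reveal q) r z t)"
proof (induction t rule: less_induct)
  case (less t)
  let ?x = "query A (reveal q) r z"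
  show ?case unfolding vanishes_from_def
  proof (intro allI impI, rule ccontr)
    fix j assume j: "successes t z \<le> j" and nz: "?x t j \<noteq> 0"
    have "j < d" using nz Rd[of t] by (metis Rd_iff not_le)
    then have "j \<in> supp d (?x t)" using nz by (simp add: supp_def)
    then obtain i where i: "i < t" "j \<in> supp d (reveal q (?x i) (z i))" using zr by blast
    then have o: "reveal q (?x i) (z i) j \<noteq> 0" by (simp add: supp_def)
    then have G: "G (?x i) j \<noteq> 0" by (auto simp: reveal_def split: if_splits)
    have van: "vanishes_from (successes i z) (?x i)" using less i by simp
    have le: "successes i z \<le> successes t z"
      unfolding successes_def using i by (intro card_mono) auto
    \<comment> \<open>\<open>G_chain\<close> excludes larger \<open>j\<close>, and monotonicity of
      \<open>successes\<close> excludes smaller ones.\<close>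
    have "j = successes i z"
      using G_chain[OF Rd van] G j le by (metis le_antisym le_trans not_le)
    then have "z i = 1" using o van by (auto simp: reveal_def split: if_splits)
    \<comment> \<open>Draw \<open>i\<close> counts at time \<open>t\<close> but not yet at time
      \<open>i\<close>.\<close>
    then have "successes i z < successes t z"
      unfolding successes_def using i by (intro psubset_card_mono) auto
    then show False using \<open>j = successes i z\<close> j by simp
  qed
qed

text \<open>Reaching accuracy \<open>\<tau>\<close> almost surely requires all \<open>d\<close>
  coordinates, hence \<open>d\<close> successes among the first \<open>N\<close> draws;
  \<open>prob_successes_le\<close> then forces \<open>p \<le> N * q / d\<close>.\<close>

lemma query_complexity_ge:
  assumes q: "0 < q" "q \<le> 1" and B: "0 \<le> B" and var: "M\<^sup>2 * (1 - q) / q \<le> \<sigma>\<^sup>2"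
    and p: "0 < p" and alg: "algorithm d S A" and zr: "zero_respecting d \<Delta> L \<sigma> B S A"
  shows "ereal (p * real d / q) \<le> query_complexity d F (reveal q) (coin q) S A \<tau> p"
  unfolding query_complexity_def
proof (rule Inf_greatest)
  let ?M = "run_space S (coin q)"
  let ?x = "\<lambda>r z. query A (reveal q) r z"
  have S: "prob_space S" using alg by (simp add: algorithm_def)
  interpret S: prob_space S by fact
  interpret \<Pi>: prob_space "\<Pi>\<^sub>M i\<in>(UNIV :: nat set). coin q"
    by (intro prob_space_PiM prob_space_coin)
  interpret SP: pair_prob_space S "\<Pi>\<^sub>M i\<in>(UNIV :: nat set). coin q" ..
  interpret M: prob_space ?M
    unfolding run_space_def by (rule SP.prob_space_axioms)
  fix y assume "y \<in> {ereal (real N) |N. p \<le> measure ?M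
    {(r, z) \<in> space ?M. \<exists>t\<le>N. enorm d (grad d F (?x r z t)) \<le> \<tau>}}"
  then obtain N where y: "y = ereal (real N)"
    and N: "p \<le> measure ?M {(r, z) \<in> space ?M. \<exists>t\<le>N. enorm d (grad d F (?x r z t)) \<le> \<tau>}"
    by blast
  have "AE (r, z) in ?M. \<forall>t. supp d (?x r z t) \<subseteq> (\<Union>i<t. supp d (reveal q (?x r z i) (z i)))"
    using zr F_smooth_class reveal_in_class[OF q B var] unfolding zero_respecting_def by fast
  then have "AE w in ?M. w \<in> {(r, z) \<in> space ?M. \<exists>t\<le>N. enorm d (grad d F (?x r z t)) \<le> \<tau>} \<longrightarrow>
    w \<in> {w \<in> space ?M. d \<le> successes N (snd w)}"
    using AE_space
  proof eventually_elim
    case (elim w)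
    obtain r z where w: "w = (r, z)" by force
    have r: "r \<in> space S" using elim(2) by (simp add: w run_space_def space_pair_measure)
    note Rd = query_Rd[OF alg r, where q = q and z = z]
    have van: "vanishes_from (successes t z) (?x r z t)" for t
      using query_vanishes_from[OF Rd] elim(1) w by auto
    have "d \<le> successes N z" if t: "t \<le> N" "enorm d (grad d F (?x r z t)) \<le> \<tau>" for t
    proof -
      have "d \<le> successes t z"
        using G_large[OF Rd van] t(2) grad_F[OF Rd] by (metis not_le)
      \<comment> \<open>Point number \<open>t\<close> depends on the first \<open>t\<close> draws
        only, so even the last point, \<open>t = N\<close>, is covered by \<open>N\<close>
        draws.\<close>
      also have "\<dots> \<le> successes N z"
        unfolding successes_def using t(1) by (intro card_mono) auto
      finally show ?thesis .
    qed
    then show ?case using elim(2) by (auto simp: w)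
  qed
  \<comment> \<open>Monotonicity up to null sets asks for measurability of the larger event
    only.\<close>
  then have "p \<le> measure ?M {w \<in> space ?M. d \<le> successes N (snd w)}"
    using q S dim_pos by (intro order.trans[OF N] M.finite_measure_mono_AE prob_successes_le) auto
  also have "\<dots> \<le> real N * q / real d"
    using q S dim_pos by (intro prob_successes_le) auto
  finally have "p * real d / q \<le> real N"
    using q dim_pos by (simp add: field_simps)
  then show "ereal (p * real d / q) \<le> y" by (simp add: y)
qed

lemma complexity_lower_bound:
  assumes \<sigma>: "0 < \<sigma>" and B: "0 \<le> B" and p: "0 < p"
    and c: "c \<le> p * real d * (1 + \<sigma>\<^sup>2 / M\<^sup>2)"
  shows "\<exists>F \<in> smooth_class d \<Delta> L. \<exists>(g, P) \<in> oracle_class d F \<sigma> B.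
      \<forall>(S :: real measure) A. algorithm d S A \<longrightarrow> zero_respecting d \<Delta> L \<sigma> B S A \<longrightarrow>
        ereal c \<le> query_complexity d F g (P :: real measure) S A \<tau> p"
proof -
  \<comment> \<open>The solution of \<open>M\<^sup>2 * (1 - q) / q = \<sigma>\<^sup>2\<close>: the
    variance budget is used up, and \<open>1 / q\<close> becomes
    \<open>1 + \<sigma>\<^sup>2 / M\<^sup>2\<close>.\<close>
  define q where "q = M\<^sup>2 / (M\<^sup>2 + \<sigma>\<^sup>2)"
  have pos: "M\<^sup>2 + \<sigma>\<^sup>2 > 0" using M_pos by (simp add: add_pos_nonneg)
  have q: "0 < q" "q \<le> 1" using M_pos pos by (simp_all add: q_def)
  have "M\<^sup>2 + \<sigma>\<^sup>2 \<noteq> 0" using pos by linarith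
  then have "1 - q = \<sigma>\<^sup>2 / (M\<^sup>2 + \<sigma>\<^sup>2)" by (simp add: q_def field_simps)
  then have var: "M\<^sup>2 * (1 - q) / q \<le> \<sigma>\<^sup>2" using M_pos pos by (simp add: q_def)
  have "1 / q = 1 + \<sigma>\<^sup>2 / M\<^sup>2" using M_pos by (simp add: q_def add_divide_distrib)
  then have "c \<le> p * real d / q" using c by (metis mult.right_neutral times_divide_eq_right)
  then have "ereal c \<le> query_complexity d F (reveal q) (coin q) S A \<tau> p"
    if "algorithm d S A" "zero_respecting d \<Delta> L \<sigma> B S A" for S :: "real measure" and A
    using query_complexity_ge[OF q B var p that] by (meson ereal_less_eq(3) order.trans)
  then show ?thesis
    using F_smooth_class reveal_in_class[OF q B var] by blast
qed

end

section \<open>The chain function\<close>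

definition clamp :: "real \<Rightarrow> real" where
  "clamp x = max 0 (min 1 x)"

text \<open>The cubic C1 step from 0 to 1 on the unit interval. Its slope vanishes at 0, which is
  what stops information from passing a zero coordinate.\<close>

definition smoothstep :: "real \<Rightarrow> real" where
  "smoothstep x = 3 * (clamp x)\<^sup>2 - 2 * (clamp x) ^ 3"

definition smoothstep' :: "real \<Rightarrow> real" where
  "smoothstep' x = 6 * clamp x * (1 - clamp x)"

text \<open>The Huber function of the negative part: 0 for \<open>x \<ge> 0\<close>, then
  \<open>x\<^sup>2 / 2\<close> down to -1, and linear with slope -1 below.\<close>

definition neg_huber :: "real \<Rightarrow> real" where
  "neg_huber x = - clamp (- x) * x - (clamp (- x))\<^sup>2 / 2"

lemma clamp_nonneg [simp]: "0 \<le> clamp x" and clamp_le_1 [simp]: "clamp x \<le> 1"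
  by (simp_all add: clamp_def)

lemma abs_clamp_diff_le: "\<bar>clamp x - clamp y\<bar> \<le> \<bar>x - y\<bar>"
  by (auto simp: clamp_def max_def min_def)

lemma smoothstep_nonneg: "0 \<le> smoothstep x"
proof -
  have "smoothstep x = (clamp x)\<^sup>2 * (3 - 2 * clamp x)"
    by (simp add: smoothstep_def power2_eq_square power3_eq_cube algebra_simps)
  also have "0 \<le> \<dots>"
    using clamp_le_1[of x] by (intro mult_nonneg_nonneg) (simp, linarith)
  finally show ?thesis .
qed

lemma smoothstep_le_1: "smoothstep x \<le> 1"
proof -
  have "1 - smoothstep x = (1 - clamp x)\<^sup>2 * (1 + 2 * clamp x)"
    by (simp add: smoothstep_def power2_eq_square power3_eq_cube algebra_simps)
  also have "0 \<le> \<dots>"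
    using clamp_nonneg[of x] by (intro mult_nonneg_nonneg) (simp, linarith)
  finally show ?thesis by simp
qed

lemma smoothstep'_nonneg: "0 \<le> smoothstep' x"
  by (simp add: smoothstep'_def)

lemma smoothstep'_le: "smoothstep' x \<le> 3 / 2"
proof -
  have "3 / 2 - smoothstep' x = 6 * (clamp x - 1 / 2)\<^sup>2"
    by (simp add: smoothstep'_def power2_eq_square algebra_simps)
  also have "0 \<le> \<dots>" by simp
  finally show ?thesis by simp
qed

lemma smoothstep'_lipschitz: "\<bar>smoothstep' x - smoothstep' y\<bar> \<le> 6 * \<bar>x - y\<bar>"
proof -
  have "smoothstep' x - smoothstep' y = 6 * ((clamp x - clamp y) * (1 - clamp x - clamp y))"
    by (simp add: smoothstep'_def algebra_simps)
  then have "\<bar>smoothstep' x - smoothstep' y\<bar> = 6 * (\<bar>clamp x - clamp y\<bar> * \<bar>1 - clamp x - clamp y\<bar>)"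
    by (simp only: abs_mult abs_numeral)
  also have "\<bar>clamp x - clamp y\<bar> * \<bar>1 - clamp x - clamp y\<bar> \<le> \<bar>x - y\<bar> * 1"
  proof (intro mult_mono abs_clamp_diff_le)
    show "\<bar>1 - clamp x - clamp y\<bar> \<le> 1"
      using clamp_nonneg[of x] clamp_nonneg[of y] clamp_le_1[of x] clamp_le_1[of y] by linarith
  qed auto
  finally show ?thesis by simp
qed

lemma smoothstep_lipschitz: "\<bar>smoothstep x - smoothstep y\<bar> \<le> 3 * \<bar>x - y\<bar>"
proof -
  let ?a = "clamp x" and ?b = "clamp y"
  have "smoothstep x - smoothstep y = (?a - ?b) * (3 * (?a + ?b) - 2 * (?a\<^sup>2 + ?a * ?b + ?b\<^sup>2))"
    by (simp add: smoothstep_def power2_eq_square power3_eq_cube algebra_simps)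
  then have "\<bar>smoothstep x - smoothstep y\<bar>
      = \<bar>?a - ?b\<bar> * \<bar>3 * (?a + ?b) - 2 * (?a\<^sup>2 + ?a * ?b + ?b\<^sup>2)\<bar>"
    by (simp add: abs_mult)
  also have "\<dots> \<le> \<bar>x - y\<bar> * 3"
  proof (intro mult_mono abs_clamp_diff_le)
    \<comment> \<open>Once these products are expanded, the quadratic bound follows by linear
      arithmetic in the monomials.\<close>
    have "0 \<le> ?a * (1 - ?a)" "0 \<le> ?b * (1 - ?b)" "0 \<le> ?a * (1 - ?b)" "0 \<le> ?b * (1 - ?a)"
      "0 \<le> ?a * ?b" "0 \<le> (1 - ?a) * (1 - ?b)"
      by (intro mult_nonneg_nonneg; simp)+
    moreover have "0 \<le> (?a + ?b - 1)\<^sup>2" "0 \<le> (?a - ?b)\<^sup>2" by simp_all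
    ultimately show "\<bar>3 * (?a + ?b) - 2 * (?a\<^sup>2 + ?a * ?b + ?b\<^sup>2)\<bar> \<le> 3"
      using clamp_nonneg[of x] clamp_nonneg[of y] clamp_le_1[of x] clamp_le_1[of y]
      by (simp add: power2_eq_square algebra_simps abs_le_iff)
  qed auto
  finally show ?thesis by simp
qed

text \<open>The error is split by first using the clamped displacement
  \<open>clamp y - clamp x\<close>, where a polynomial identity gives 3, and then passing to
  \<open>y - x\<close>, which costs another 6.\<close>

lemma smoothstep_taylor:
  "\<bar>smoothstep y - smoothstep x - smoothstep' x * (y - x)\<bar> \<le> 9 * (y - x)\<^sup>2"
proof -
  let ?a = "clamp x" and ?b = "clamp y"
  have "smoothstep y - smoothstep x - smoothstep' x * (?b - ?a) = (?b - ?a)\<^sup>2 * (3 - 4 * ?a - 2 * ?b)"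
    by (simp add: smoothstep_def smoothstep'_def power2_eq_square power3_eq_cube algebra_simps)
  then have "\<bar>smoothstep y - smoothstep x - smoothstep' x * (?b - ?a)\<bar>
      = (?b - ?a)\<^sup>2 * \<bar>3 - 4 * ?a - 2 * ?b\<bar>"
    by (simp add: abs_mult)
  also have "\<dots> \<le> (y - x)\<^sup>2 * 3"
  proof (intro mult_mono)
    show "(?b - ?a)\<^sup>2 \<le> (y - x)\<^sup>2"
      using abs_clamp_diff_le[of y x] by (simp add: abs_le_square_iff)
    show "\<bar>3 - 4 * ?a - 2 * ?b\<bar> \<le> 3"
      using clamp_nonneg[of x] clamp_nonneg[of y] clamp_le_1[of x] clamp_le_1[of y] by linarith
  qed auto
  finally have 1: "\<bar>smoothstep y - smoothstep x - smoothstep' x * (?b - ?a)\<bar> \<le> 3 * (y - x)\<^sup>2"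
    by simp
  have "?a * (1 - ?a) * \<bar>?b - ?a - (y - x)\<bar> \<le> (y - x)\<^sup>2"
  proof (cases "0 < x \<and> x < 1")
    case True
    then have a: "?a = x" by (simp add: clamp_def)
    show ?thesis
    proof (cases "0 \<le> y \<and> y \<le> 1")
      case True
      then show ?thesis using a by (simp add: clamp_def)
    next
      case False
      define u where "u = \<bar>y - x\<bar>"
      \<comment> \<open>Here \<open>y\<close> lies outside the unit interval, so the segment from
        \<open>x\<close> to \<open>y\<close> crosses an endpoint; \<open>x * (1 - x)\<close> is at
        most the distance from \<open>x\<close> to either endpoint.\<close>
      have u: "\<bar>?b - ?a - (y - x)\<bar> \<le> u" "x * (1 - x) \<le> u"
      proof -
        show "\<bar>?b - ?a - (y - x)\<bar> \<le> u"
          using False True unfolding a u_def by (auto simp: clamp_def)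
        have "x * (1 - x) \<le> x" "x * (1 - x) \<le> 1 - x"
          using True by (simp_all add: mult_left_le mult_left_le_one_le)
        then show "x * (1 - x) \<le> u" using False True unfolding u_def by linarith
      qed
      have "x * (1 - x) * \<bar>?b - ?a - (y - x)\<bar> \<le> u * u"
        using u True by (intro mult_mono) (auto simp: u_def)
      then show ?thesis unfolding a by (simp add: u_def power2_eq_square)
    qed
  next
    case False
    then have "?a * (1 - ?a) = 0" by (auto simp: clamp_def)
    then show ?thesis by (simp only:) simp
  qed
  then have 2: "\<bar>smoothstep' x * (?b - ?a - (y - x))\<bar> \<le> 6 * (y - x)\<^sup>2"
    by (simp add: smoothstep'_def abs_mult)
  have "smoothstep y - smoothstep x - smoothstep' x * (y - x)
      = (smoothstep y - smoothstep x - smoothstep' x * (?b - ?a)) + smoothstep' x * (?b - ?a - (y - x))"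
    by (simp add: algebra_simps)
  then show ?thesis using 1 2 by linarith
qed

text \<open>A dual description: \<open>neg_huber\<close> is the maximum of these affine functions,
  attained at \<open>c = clamp (- x)\<close>, the projection of \<open>- x\<close> to the unit
  interval. The first inequality of the proof characterizes that projection.\<close>

lemma neg_huber_ge: "- c * x - c\<^sup>2 / 2 \<le> neg_huber x" if "0 \<le> c" "c \<le> 1"
proof -
  let ?a = "clamp (- x)"
  have "(?a - c) * (- x - ?a) \<ge> 0"
    using that by (auto simp: clamp_def max_def min_def mult_nonpos_nonpos)
  moreover have "(?a - c)\<^sup>2 \<ge> 0" by simp
  ultimately show ?thesis
    unfolding neg_huber_def by (simp add: power2_eq_square algebra_simps)
qed

lemma neg_huber_nonneg: "0 \<le> neg_huber x"
  using neg_huber_ge[of 0 x] by simp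

text \<open>Convexity used twice: the supporting line at \<open>x\<close> evaluated at
  \<open>y\<close> bounds from below, the one at \<open>y\<close> evaluated at \<open>x\<close> from
  above.\<close>

lemma neg_huber_taylor: "\<bar>neg_huber y - neg_huber x + clamp (- x) * (y - x)\<bar> \<le> (y - x)\<^sup>2"
proof -
  let ?a = "clamp (- x)" and ?b = "clamp (- y)"
  have 1: "0 \<le> neg_huber y - neg_huber x + ?a * (y - x)"
    using neg_huber_ge[of ?a y] by (simp add: neg_huber_def algebra_simps)
  have "neg_huber y - neg_huber x + ?a * (y - x) \<le> (?a - ?b) * (y - x)"
    using neg_huber_ge[of ?b x] by (simp add: neg_huber_def algebra_simps)
  also have "\<dots> \<le> \<bar>?a - ?b\<bar> * \<bar>y - x\<bar>"
    by (simp add: abs_mult[symmetric])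
  also have "\<dots> \<le> \<bar>y - x\<bar> * \<bar>y - x\<bar>"
    using abs_clamp_diff_le[of "- x" "- y"] by (intro mult_right_mono) auto
  finally show ?thesis using 1 by (simp add: power2_eq_square)
qed

text \<open>The step stretched to the interval from -2 to 2, so that its slope stays above 1/4 on
  all of [-1, 1], in particular at an undiscovered coordinate with value 0.\<close>

definition drive :: "real \<Rightarrow> real" where
  "drive x = smoothstep ((x + 2) / 4)"

definition drive' :: "real \<Rightarrow> real" where
  "drive' x = smoothstep' ((x + 2) / 4) / 4"

lemma drive_bounds: "0 \<le> drive x" "drive x \<le> 1" "0 \<le> drive' x" "drive' x \<le> 3 / 8"
  using smoothstep_nonneg smoothstep_le_1 smoothstep'_nonneg smoothstep'_le[of "(x + 2) / 4"]
  by (simp_all add: drive_def drive'_def)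

lemma drive_lipschitz: "\<bar>drive x - drive y\<bar> \<le> \<bar>x - y\<bar>"
  and drive'_lipschitz: "\<bar>drive' x - drive' y\<bar> \<le> \<bar>x - y\<bar>"
proof -
  have d: "\<bar>(x + 2) / 4 - (y + 2) / 4\<bar> = \<bar>x - y\<bar> / 4" by (simp add: abs_if field_simps)
  have "\<bar>drive x - drive y\<bar> \<le> 3 * (\<bar>x - y\<bar> / 4)"
    using smoothstep_lipschitz[of "(x + 2) / 4" "(y + 2) / 4"] unfolding d drive_def .
  also have "\<dots> \<le> \<bar>x - y\<bar>" by simp
  finally show "\<bar>drive x - drive y\<bar> \<le> \<bar>x - y\<bar>" .
  have "\<bar>drive' x - drive' y\<bar> = \<bar>smoothstep' ((x + 2) / 4) - smoothstep' ((y + 2) / 4)\<bar> / 4"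
    by (simp add: drive'_def diff_divide_distrib[symmetric])
  also have "\<dots> \<le> 6 * (\<bar>x - y\<bar> / 4) / 4"
    using smoothstep'_lipschitz[of "(x + 2) / 4" "(y + 2) / 4"] unfolding d
    by (rule divide_right_mono) simp
  also have "\<dots> \<le> \<bar>x - y\<bar>" by simp
  finally show "\<bar>drive' x - drive' y\<bar> \<le> \<bar>x - y\<bar>" .
qed

lemma drive_taylor: "\<bar>drive y - drive x - drive' x * (y - x)\<bar> \<le> (y - x)\<^sup>2"
proof -
  have d: "(y + 2) / 4 - (x + 2) / 4 = (y - x) / 4" by (simp add: field_simps)
  have "9 * ((y - x) / 4)\<^sup>2 \<le> (y - x)\<^sup>2" by (simp add: power2_eq_square)
  then show ?thesis
    using smoothstep_taylor[of "(y + 2) / 4" "(x + 2) / 4"] unfolding d drive_def drive'_def by simp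
qed

lemma drive'_gt: "1 / 4 < drive' x" if "\<bar>x\<bar> \<le> 1"
proof -
  define u where "u = (x + 2) / 4"
  have u: "0 \<le> u - 1 / 4" "0 \<le> 3 / 4 - u" using that by (auto simp: u_def abs_le_iff)
  then have "clamp u = u" by (simp add: clamp_def)
  moreover have "0 \<le> (u - 1 / 4) * (3 / 4 - u)" using u by (rule mult_nonneg_nonneg)
  then have "3 / 16 \<le> u * (1 - u)" by (simp add: field_simps)
  ultimately show ?thesis
    unfolding drive'_def u_def[symmetric] smoothstep'_def by simp
qed

text \<open>The product rule with remainder: each factor contributes its own Taylor error, and the
  product of the two increments is split by \<open>2 * A * B \<le> A\<^sup>2 + B\<^sup>2\<close>.
  The larger coefficient, 9 + 3/2, is rounded up to 11.\<close>

lemma coupling_taylor: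
  "\<bar>smoothstep a' * drive b' - smoothstep a * drive b
     - smoothstep' a * drive b * (a' - a) - smoothstep a * drive' b * (b' - b)\<bar>
    \<le> 11 * ((a' - a)\<^sup>2 + (b' - b)\<^sup>2)"
proof -
  define A B where "A = a' - a" and "B = b' - b"
  define r where "r = smoothstep a' - smoothstep a - smoothstep' a * A"
  define s where "s = drive b' - drive b - drive' b * B"
  have "\<bar>r * drive b\<bar> \<le> 9 * A\<^sup>2 * 1"
    unfolding abs_mult using smoothstep_taylor[of a' a] drive_bounds[of b]
    by (intro mult_mono) (auto simp: r_def A_def)
  moreover have "\<bar>smoothstep a * s\<bar> \<le> 1 * B\<^sup>2"
    unfolding abs_mult using drive_taylor[of b' b] smoothstep_nonneg[of a] smoothstep_le_1[of a]
    by (intro mult_mono) (auto simp: s_def B_def)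
  moreover have "\<bar>(smoothstep a' - smoothstep a) * (drive b' - drive b)\<bar> \<le> 3 * \<bar>A\<bar> * \<bar>B\<bar>"
    unfolding abs_mult A_def B_def
    by (intro mult_mono smoothstep_lipschitz drive_lipschitz) auto
  ultimately have "\<bar>r * drive b + smoothstep a * s + (smoothstep a' - smoothstep a) * (drive b' - drive b)\<bar>
      \<le> 9 * A\<^sup>2 * 1 + 1 * B\<^sup>2 + 3 * \<bar>A\<bar> * \<bar>B\<bar>"
    by (intro order.trans[OF abs_triangle_ineq] add_mono)
  also have "\<dots> \<le> 9 * A\<^sup>2 * 1 + 1 * B\<^sup>2 + 3 / 2 * (A\<^sup>2 + B\<^sup>2)"
    using sum_squares_bound[of "\<bar>A\<bar>" "\<bar>B\<bar>"] by (intro add_left_mono) simp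
  also have "\<dots> \<le> 11 * (A\<^sup>2 + B\<^sup>2)"
    using zero_le_power2[of A] zero_le_power2[of B] unfolding distrib_left by linarith
  also have "r * drive b + smoothstep a * s + (smoothstep a' - smoothstep a) * (drive b' - drive b)
    = smoothstep a' * drive b' - smoothstep a * drive b
      - smoothstep' a * drive b * A - smoothstep a * drive' b * B"
    by (simp add: r_def s_def algebra_simps)
  finally show ?thesis unfolding A_def B_def .
qed

text \<open>The coordinate before the first one is read as 1; this starts the chain.\<close>

definition prev :: "(nat \<Rightarrow> real) \<Rightarrow> nat \<Rightarrow> real" where
  "prev x i = (case i of 0 \<Rightarrow> 1 | Suc j \<Rightarrow> x j)"

text \<open>The coupling rewards raising \<open>x i\<close> only once the preceding coordinate is
  positive. The penalty \<open>neg_huber\<close> keeps the gradient large at very negative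
  \<open>x i\<close>, where \<open>drive\<close> is flat.\<close>

definition chain :: "nat \<Rightarrow> (nat \<Rightarrow> real) \<Rightarrow> real" where
  "chain T x = (\<Sum>i<T. neg_huber (x i) - smoothstep (prev x i) * drive (x i))"

definition next_drive :: "nat \<Rightarrow> (nat \<Rightarrow> real) \<Rightarrow> nat \<Rightarrow> real" where
  "next_drive T x i = (if Suc i < T then drive (x (Suc i)) else 0)"

text \<open>No cancellation: all three terms of a partial derivative are nonpositive.\<close>

definition chain_grad :: "nat \<Rightarrow> (nat \<Rightarrow> real) \<Rightarrow> nat \<Rightarrow> real" where
  "chain_grad T x i = (if i < T then
     - clamp (- x i) - smoothstep (prev x i) * drive' (x i) - smoothstep' (x i) * next_drive T x i
   else 0)"

text \<open>Reassigns the derivative in the preceding coordinate from the summand where it arises to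
  the coordinate it belongs to. The term at 0 is absent because the predecessor there is
  constant.\<close>

lemma sum_shift:
  "(\<Sum>i<T. case i of 0 \<Rightarrow> 0 | Suc j \<Rightarrow> f j) = (\<Sum>i<T. if Suc i < T then f i else (0 :: real))"
proof (cases T)
  case (Suc n)
  have "(\<Sum>i<Suc n. case i of 0 \<Rightarrow> 0 | Suc j \<Rightarrow> f j) = (\<Sum>i<n. f i)"
    by (simp add: sum.lessThan_Suc_shift del: sum.lessThan_Suc)
  then show ?thesis by (simp add: Suc)
qed simp

lemma sum_prev_diff_sq_le:
  "(\<Sum>i<T. (prev y i - prev x i)\<^sup>2) \<le> (\<Sum>i<T. (y i - x i)\<^sup>2)"
proof -
  have "(prev y i - prev x i)\<^sup>2 = (case i of 0 \<Rightarrow> 0 | Suc j \<Rightarrow> (y j - x j)\<^sup>2)" for i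
    by (simp add: prev_def split: nat.split)
  then have "(\<Sum>i<T. (prev y i - prev x i)\<^sup>2) = (\<Sum>i<T. if Suc i < T then (y i - x i)\<^sup>2 else 0)"
    using sum_shift[of "\<lambda>i. (y i - x i)\<^sup>2" T] by simp
  also have "\<dots> \<le> (\<Sum>i<T. (y i - x i)\<^sup>2)" by (intro sum_mono) auto
  finally show ?thesis .
qed

lemma sum_next_sq_le:
  fixes u :: "nat \<Rightarrow> real"
  shows "(\<Sum>i<T. (if Suc i < T then u (Suc i) else 0)\<^sup>2) \<le> (\<Sum>i<T. (u i)\<^sup>2)"
proof (cases T)
  case (Suc n)
  have "(\<Sum>i<n. (if Suc i < Suc n then u (Suc i) else 0)\<^sup>2) = (\<Sum>i<n. (u (Suc i))\<^sup>2)"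
    by (intro sum.cong) auto
  then have "(\<Sum>i<Suc n. (if Suc i < Suc n then u (Suc i) else 0)\<^sup>2) = (\<Sum>i<n. (u (Suc i))\<^sup>2)"
    by simp
  also have "\<dots> \<le> (\<Sum>i<Suc n. (u i)\<^sup>2)"
    by (simp add: sum.lessThan_Suc_shift del: sum.lessThan_Suc)
  finally show ?thesis by (simp only: Suc)
qed simp

lemma chain_taylor:
  "\<bar>chain T y - chain T x - (\<Sum>i<T. chain_grad T x i * (y i - x i))\<bar>
    \<le> 23 * (\<Sum>i<T. (y i - x i)\<^sup>2)"
proof -
  define h where "h = (\<lambda>i. neg_huber (y i) - neg_huber (x i) + clamp (- x i) * (y i - x i))"
  define k where "k = (\<lambda>i. smoothstep (prev y i) * drive (y i) - smoothstep (prev x i) * drive (x i)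
    - smoothstep' (prev x i) * drive (x i) * (prev y i - prev x i)
    - smoothstep (prev x i) * drive' (x i) * (y i - x i))"
  have "smoothstep' (prev x i) * drive (x i) * (prev y i - prev x i)
      = (case i of 0 \<Rightarrow> 0 | Suc j \<Rightarrow> smoothstep' (x j) * drive (x (Suc j)) * (y j - x j))" for i
    by (simp add: prev_def split: nat.split)
  then have shift: "(\<Sum>i<T. smoothstep' (prev x i) * drive (x i) * (prev y i - prev x i))
      = (\<Sum>i<T. smoothstep' (x i) * next_drive T x i * (y i - x i))"
    using sum_shift[of "\<lambda>i. smoothstep' (x i) * drive (x (Suc i)) * (y i - x i)" T]
    by (simp add: next_drive_def if_distrib if_distribR cong: if_cong)
  have "chain T y - chain T x - (\<Sum>i<T. chain_grad T x i * (y i - x i)) =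
      (\<Sum>i<T. h i - k i - smoothstep' (prev x i) * drive (x i) * (prev y i - prev x i)
        + smoothstep' (x i) * next_drive T x i * (y i - x i))"
    unfolding chain_def sum_subtractf[symmetric]
    by (intro sum.cong) (auto simp: chain_grad_def h_def k_def algebra_simps)
  also have "\<dots> = (\<Sum>i<T. h i - k i)"
    by (simp add: sum.distrib sum_subtractf shift)
  \<comment> \<open>12 is 1 from the penalty plus 11 from the coupling; the shifted squares then add
    another 11 to give 23.\<close>
  also have "\<bar>\<dots>\<bar> \<le> (\<Sum>i<T. 12 * (y i - x i)\<^sup>2 + 11 * (prev y i - prev x i)\<^sup>2)"
  proof (rule order.trans[OF sum_abs sum_mono])
    fix i
    have "\<bar>h i\<bar> \<le> (y i - x i)\<^sup>2"
      unfolding h_def by (rule neg_huber_taylor)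
    moreover have "\<bar>k i\<bar> \<le> 11 * ((prev y i - prev x i)\<^sup>2 + (y i - x i)\<^sup>2)"
      unfolding k_def by (rule coupling_taylor)
    ultimately show "\<bar>h i - k i\<bar> \<le> 12 * (y i - x i)\<^sup>2 + 11 * (prev y i - prev x i)\<^sup>2"
      by simp
  qed
  also have "\<dots> = 12 * (\<Sum>i<T. (y i - x i)\<^sup>2) + 11 * (\<Sum>i<T. (prev y i - prev x i)\<^sup>2)"
    by (simp add: sum.distrib sum_distrib_left)
  also have "\<dots> \<le> 23 * (\<Sum>i<T. (y i - x i)\<^sup>2)"
    using sum_prev_diff_sq_le[of y x T] by simp
  finally show ?thesis .
qed

section \<open>Lipschitz continuity of the gradient of the chain\<close>

lemma abs_mult_diff_le:
  fixes a b a' b' :: real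
  shows "\<bar>a * b - a' * b'\<bar> \<le> \<bar>a - a'\<bar> * \<bar>b\<bar> + \<bar>a'\<bar> * \<bar>b - b'\<bar>"
proof -
  have "a * b - a' * b' = (a - a') * b + a' * (b - b')" by (simp add: algebra_simps)
  then show ?thesis by (metis abs_mult abs_triangle_ineq)
qed

lemma chain_grad_diff_le:
  assumes "i < T"
  shows "\<bar>chain_grad T x i - chain_grad T y i\<bar> \<le> 8 * (\<bar>x i - y i\<bar> + \<bar>prev x i - prev y i\<bar>
    + \<bar>if Suc i < T then x (Suc i) - y (Suc i) else 0\<bar>)"
    (is "_ \<le> 8 * (?D + ?P + \<bar>?N\<bar>)")
proof -
  have 1: "\<bar>clamp (- x i) - clamp (- y i)\<bar> \<le> ?D"
    using abs_clamp_diff_le[of "- x i" "- y i"] by linarith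
  have "\<bar>smoothstep (prev x i) * drive' (x i) - smoothstep (prev y i) * drive' (y i)\<bar>
      \<le> \<bar>smoothstep (prev x i) - smoothstep (prev y i)\<bar> * \<bar>drive' (x i)\<bar>
        + \<bar>smoothstep (prev y i)\<bar> * \<bar>drive' (x i) - drive' (y i)\<bar>"
    by (rule abs_mult_diff_le)
  also have "\<dots> \<le> (3 * ?P) * 1 + 1 * ?D"
    using drive_bounds[of "x i"] smoothstep_nonneg[of "prev y i"] smoothstep_le_1[of "prev y i"]
    by (intro add_mono mult_mono smoothstep_lipschitz drive'_lipschitz) auto
  finally have 2: "\<bar>smoothstep (prev x i) * drive' (x i) - smoothstep (prev y i) * drive' (y i)\<bar>
      \<le> 3 * ?P + ?D" by simp
  have N: "\<bar>next_drive T x i - next_drive T y i\<bar> \<le> \<bar>?N\<bar>"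
    using drive_lipschitz by (simp add: next_drive_def)
  have "\<bar>smoothstep' (x i) * next_drive T x i - smoothstep' (y i) * next_drive T y i\<bar>
      \<le> \<bar>smoothstep' (x i) - smoothstep' (y i)\<bar> * \<bar>next_drive T x i\<bar>
        + \<bar>smoothstep' (y i)\<bar> * \<bar>next_drive T x i - next_drive T y i\<bar>"
    by (rule abs_mult_diff_le)
  also have "\<dots> \<le> (6 * ?D) * 1 + 2 * \<bar>?N\<bar>"
    using drive_bounds[of "x (Suc i)"] smoothstep'_nonneg[of "y i"] smoothstep'_le[of "y i"]
    by (intro add_mono mult_mono smoothstep'_lipschitz N) (auto simp: next_drive_def)
  finally have 3: "\<bar>smoothstep' (x i) * next_drive T x i - smoothstep' (y i) * next_drive T y i\<bar>
      \<le> 6 * ?D + 2 * \<bar>?N\<bar>" by simp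
  \<comment> \<open>8 is the total coefficient of \<open>D\<close>, namely 1 + 1 + 6;
    \<open>P\<close> and \<open>N\<close> come with 3 and 2.\<close>
  have combine: "\<bar>(- a - b - c) - (- a' - b' - c')\<bar> \<le> 8 * (D + P + N)"
    if "\<bar>a - a'\<bar> \<le> D" "\<bar>b - b'\<bar> \<le> 3 * P + D" "\<bar>c - c'\<bar> \<le> 6 * D + 2 * N" "0 \<le> P" "0 \<le> N"
    for a b c a' b' c' D P N :: real
    using that by (simp add: abs_le_iff)
  show ?thesis
    unfolding chain_grad_def using assms by (simp only: if_True combine[OF 1 2 3] abs_ge_zero)
qed

lemma chain_grad_lipschitz:
  "edist T (chain_grad T x) (chain_grad T y) \<le> 24 * edist T x y"
proof -
  define D P N where "D = (\<lambda>i. x i - y i)" and "P = (\<lambda>i. prev x i - prev y i)"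
    and "N = (\<lambda>i. if Suc i < T then x (Suc i) - y (Suc i) else 0)"
  \<comment> \<open>192 is 3 times 64 by Cauchy-Schwarz. Since the gradient is tridiagonal, the
    three sums below are each at most that of \<open>D\<close>, and 3 times 192 is the square of
    24.\<close>
  have sq: "(8 * (u + v + w))\<^sup>2 \<le> 192 * (u\<^sup>2 + v\<^sup>2 + w\<^sup>2)" for u v w :: real
    using sum_squares_bound[of u v] sum_squares_bound[of u w] sum_squares_bound[of v w]
    by (simp add: power2_eq_square algebra_simps)
  have "(\<Sum>i<T. (chain_grad T x i - chain_grad T y i)\<^sup>2)
      \<le> (\<Sum>i<T. 192 * ((D i)\<^sup>2 + (P i)\<^sup>2 + (N i)\<^sup>2))"
  proof (rule sum_mono)
    fix i assume "i \<in> {..<T}"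
    then have "\<bar>chain_grad T x i - chain_grad T y i\<bar> \<le> 8 * (\<bar>D i\<bar> + \<bar>P i\<bar> + \<bar>N i\<bar>)"
      unfolding D_def P_def N_def by (intro chain_grad_diff_le) simp
    then have "(chain_grad T x i - chain_grad T y i)\<^sup>2 \<le> (8 * (\<bar>D i\<bar> + \<bar>P i\<bar> + \<bar>N i\<bar>))\<^sup>2"
      by (metis abs_ge_zero power2_abs power_mono)
    also have "\<dots> \<le> 192 * ((D i)\<^sup>2 + (P i)\<^sup>2 + (N i)\<^sup>2)"
      using sq[of "\<bar>D i\<bar>" "\<bar>P i\<bar>" "\<bar>N i\<bar>"] by simp
    finally show "(chain_grad T x i - chain_grad T y i)\<^sup>2 \<le> 192 * ((D i)\<^sup>2 + (P i)\<^sup>2 + (N i)\<^sup>2)" .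
  qed
  also have "\<dots> = 192 * ((\<Sum>i<T. (D i)\<^sup>2) + (\<Sum>i<T. (P i)\<^sup>2) + (\<Sum>i<T. (N i)\<^sup>2))"
    by (simp add: sum.distrib sum_distrib_left)
  also have "\<dots> \<le> 192 * ((\<Sum>i<T. (D i)\<^sup>2) + (\<Sum>i<T. (D i)\<^sup>2) + (\<Sum>i<T. (D i)\<^sup>2))"
    using sum_prev_diff_sq_le[of x y T] sum_next_sq_le[of T D]
    unfolding D_def P_def N_def by (intro mult_left_mono add_mono) auto
  also have "\<dots> = (24 * edist T x y)\<^sup>2"
    by (simp add: edist_def D_def enorm_sq power_mult_distrib)
  finally have "(edist T (chain_grad T x) (chain_grad T y))\<^sup>2 \<le> (24 * edist T x y)\<^sup>2"
    by (simp only: edist_def enorm_sq)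
  then show ?thesis by (rule power2_le_imp_le) simp
qed

section \<open>Function gap, zero-chain property and size of the gradient\<close>

lemma chain_ge: "chain T (\<lambda>_. 0) - real T \<le> chain T x"
proof -
  have "chain T (\<lambda>_. 0) \<le> 0"
    unfolding chain_def using neg_huber_ge[of 0 0] smoothstep_nonneg drive_bounds
    by (intro sum_nonpos) (simp add: neg_huber_def clamp_def)
  moreover have "(\<Sum>i<T. - 1) \<le> chain T x"
    unfolding chain_def
  proof (rule sum_mono)
    fix i
    have "smoothstep (prev x i) * drive (x i) \<le> 1 * 1"
      using smoothstep_le_1 drive_bounds by (intro mult_mono) auto
    then show "- 1 \<le> neg_huber (x i) - smoothstep (prev x i) * drive (x i)"
      using neg_huber_nonneg[of "x i"] by simp
  qed
  ultimately show ?thesis by simp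
qed

text \<open>Beyond the frontier both \<open>x i\<close> and its predecessor are 0, and
  \<open>clamp\<close>, \<open>smoothstep\<close> and \<open>smoothstep'\<close> all vanish at
  0.\<close>

lemma chain_grad_eq_0:
  assumes "vanishes_from k x" "k < i"
  shows "chain_grad T x i = 0"
proof -
  obtain j where "i = Suc j" "k \<le> j" using assms(2) by (cases i) auto
  then have "x i = 0" "prev x i = 0"
    using assms(1) by (auto simp: vanishes_from_def prev_def)
  then show ?thesis
    by (simp add: chain_grad_def clamp_def smoothstep_def smoothstep'_def)
qed

lemma abs_chain_grad_le: "\<bar>chain_grad T x i\<bar> \<le> 3"
proof -
  have "smoothstep (prev x i) * drive' (x i) \<le> 1 * (3 / 8)"
    "smoothstep' (x i) * next_drive T x i \<le> 3 / 2 * 1"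
    using smoothstep_le_1 smoothstep_nonneg smoothstep'_nonneg smoothstep'_le
      drive_bounds[of "x i"] drive_bounds[of "x (Suc i)"]
    by (intro mult_mono; simp add: next_drive_def)+
  moreover have "0 \<le> smoothstep (prev x i) * drive' (x i)" "0 \<le> smoothstep' (x i) * next_drive T x i"
    using smoothstep_nonneg smoothstep'_nonneg drive_bounds
    by (simp_all add: next_drive_def)
  ultimately have "\<bar>- clamp (- x i) - smoothstep (prev x i) * drive' (x i)
      - smoothstep' (x i) * next_drive T x i\<bar> \<le> 3"
    using clamp_nonneg[of "- x i"] clamp_le_1[of "- x i"] by linarith
  then show ?thesis by (simp add: chain_grad_def)
qed

text \<open>The gradient is large at the first coordinate below 1: its predecessor is at least 1,
  so that its driving term is switched on.\<close>

lemma chain_grad_large: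
  assumes "vanishes_from k x" "k < T"
  shows "1 / 4 < enorm T (chain_grad T x)"
proof -
  define i where "i = (LEAST i. x i < 1)"
  have k: "x k < 1" using assms(1) by (simp add: vanishes_from_def)
  have xi: "x i < 1" unfolding i_def using k by (rule LeastI)
  have iT: "i < T" using Least_le[of "\<lambda>i. x i < 1", OF k] assms(2) by (simp add: i_def)
  have "1 \<le> prev x i"
  proof (cases i)
    case (Suc j)
    then have "\<not> x j < 1" using not_less_Least[of j "\<lambda>i. x i < 1"] by (simp add: i_def)
    then show ?thesis by (simp add: prev_def Suc)
  qed (simp add: prev_def)
  then have step: "smoothstep (prev x i) = 1" by (simp add: smoothstep_def clamp_def)
  \<comment> \<open>Far to the left the penalty has slope 1; between -1 and 1 the driving term alone
    suffices.\<close>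
  have "1 / 4 < clamp (- x i) + drive' (x i)"
  proof (cases "x i \<le> - 1")
    case True
    then have "clamp (- x i) = 1" by (simp add: clamp_def)
    then show ?thesis using drive_bounds(3)[of "x i"] by simp
  next
    case False
    then have "1 / 4 < drive' (x i)" using xi by (intro drive'_gt) simp
    then show ?thesis using clamp_nonneg[of "- x i"] by linarith
  qed
  moreover have "0 \<le> smoothstep' (x i) * next_drive T x i"
    using smoothstep'_nonneg drive_bounds by (simp add: next_drive_def)
  ultimately have "1 / 4 < \<bar>chain_grad T x i\<bar>"
    using iT step by (simp add: chain_grad_def)
  also have "\<dots> \<le> enorm T (chain_grad T x)" using iT by (rule abs_le_enorm)
  finally show ?thesis .
qed

section \<open>The two hard instances\<close>

lemma chain_grad_measurable:
  "(\<lambda>x. chain_grad T (\<lambda>j. b * x j) i) \<in> borel_measurable (borel_Rd d)"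
proof -
  have [measurable]: "(\<lambda>x. prev (\<lambda>j. b * x j) i) \<in> borel_measurable (borel_Rd d)"
    unfolding prev_def by (cases i) simp_all
  show ?thesis
    unfolding chain_grad_def next_drive_def drive_def drive'_def smoothstep_def smoothstep'_def clamp_def
    by measurable
qed

text \<open>Values scale by \<open>a\<close>, gradients by \<open>a * b\<close> and Lipschitz
  constants by \<open>a * b\<^sup>2\<close>, so the two parameters can meet a prescribed smoothness
  and a prescribed gradient size.\<close>

lemma zero_chain_chain:
  assumes T: "0 < T" and a: "0 < a" and b: "0 < b" and gap: "a * real T \<le> \<Delta>"
  shows "zero_chain T (\<lambda>x. a * chain T (\<lambda>i. b * x i)) (\<lambda>x i. a * b * chain_grad T (\<lambda>i. b * x i) i)
    (a * b\<^sup>2 * 23) (a * b\<^sup>2 * 24) \<Delta> (a * b * 3) (a * b / 4)"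
proof
  fix x y :: "nat \<Rightarrow> real"
  let ?x = "\<lambda>i. b * x i" and ?y = "\<lambda>i. b * y i"
  have "a * chain T ?y - a * chain T ?x - (\<Sum>i<T. a * b * chain_grad T ?x i * (y i - x i))
      = a * (chain T ?y - chain T ?x - (\<Sum>i<T. chain_grad T ?x i * (b * y i - b * x i)))"
    by (simp add: sum_distrib_left algebra_simps sum_subtractf)
  also have "\<bar>\<dots>\<bar> \<le> a * (23 * (\<Sum>i<T. (b * y i - b * x i)\<^sup>2))"
    unfolding abs_mult using a chain_taylor[of T ?y ?x] by simp
  also have "(\<Sum>i<T. (b * y i - b * x i)\<^sup>2) = b\<^sup>2 * (\<Sum>i<T. (y i - x i)\<^sup>2)"
    by (simp add: sum_distrib_left power_mult_distrib flip: right_diff_distrib)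
  finally show "\<bar>a * chain T ?y - a * chain T ?x - (\<Sum>i<T. a * b * chain_grad T ?x i * (y i - x i))\<bar>
      \<le> a * b\<^sup>2 * 23 * (\<Sum>i<T. (y i - x i)\<^sup>2)"
    by (simp add: mult_ac)
  have "edist T (\<lambda>i. a * b * chain_grad T ?x i) (\<lambda>i. a * b * chain_grad T ?y i)
      = a * b * edist T (chain_grad T ?x) (chain_grad T ?y)"
    using a b by (simp add: edist_def enorm_scale flip: right_diff_distrib)
  also have "\<dots> \<le> a * b * (24 * edist T ?x ?y)"
    using a b by (intro mult_left_mono chain_grad_lipschitz) simp
  also have "edist T ?x ?y = b * edist T x y"
    using b by (simp add: edist_def enorm_scale flip: right_diff_distrib)
  finally show "edist T (\<lambda>i. a * b * chain_grad T ?x i) (\<lambda>i. a * b * chain_grad T ?y i)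
      \<le> a * b\<^sup>2 * 24 * edist T x y"
    by (simp add: power2_eq_square mult_ac)
  have "a * (chain T (\<lambda>_. 0) - real T) \<le> a * chain T ?x"
    using a by (intro mult_left_mono chain_ge) simp
  then show "a * chain T (\<lambda>i. b * 0) - \<Delta> \<le> a * chain T ?x"
    using gap by (simp add: algebra_simps)
  fix k assume "vanishes_from k x"
  then have van: "vanishes_from k ?x" by (simp add: vanishes_from_def)
  show "a * b * chain_grad T ?x i = 0" if "k < i" for i
    using chain_grad_eq_0[OF van that] by simp
  show "\<bar>a * b * chain_grad T ?x k\<bar> \<le> a * b * 3"
    unfolding abs_mult using a b abs_chain_grad_le[of T ?x k] by simp
  show "a * b / 4 < enorm T (\<lambda>i. a * b * chain_grad T ?x i)" if "k < T"
    using chain_grad_large[OF van that] a b mult_strict_left_mono[of "1 / 4" _ "a * b"]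
    by (simp add: enorm_scale)
next
  show "a * b * chain_grad T (\<lambda>i. b * x i) i = 0" if "T \<le> i" for x i
    using that by (simp add: chain_grad_def)
  show "(\<lambda>x. a * b * chain_grad T (\<lambda>i. b * x i) i) \<in> borel_measurable (borel_Rd T)" for i
    using chain_grad_measurable by measurable
qed (use T a b in simp_all)

text \<open>The parabola of curvature \<open>L\<close> that drops by exactly \<open>\<Delta>\<close>
  from the origin to its minimum at \<open>a\<close>; its slope at 0 is the largest in absolute
  value that the class permits. For dimension 1 the only undiscovered situation is
  \<open>x 0 = 0\<close>.\<close>

lemma zero_chain_quadratic:
  assumes L: "0 < L" and \<Delta>: "0 < \<Delta>" and \<tau>: "\<tau> < sqrt (2 * \<Delta> * L)"
  defines "a \<equiv> sqrt (2 * \<Delta> / L)"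
  shows "zero_chain 1 (\<lambda>x. L / 2 * (x 0 - a)\<^sup>2) (\<lambda>x i. if i = 0 then L * (x 0 - a) else 0)
    (L / 2) L \<Delta> (sqrt (2 * \<Delta> * L)) \<tau>"
proof
  have a: "0 < a" using L \<Delta> by (simp add: a_def)
  have La: "L * a = sqrt (2 * \<Delta> * L)"
  proof (rule real_sqrt_unique[symmetric])
    show "(L * a)\<^sup>2 = 2 * \<Delta> * L"
      using L \<Delta> by (simp add: a_def power_mult_distrib) (simp add: power2_eq_square)
  qed (use L a in simp)
  fix x y :: "nat \<Rightarrow> real"
  show "\<bar>L / 2 * (y 0 - a)\<^sup>2 - L / 2 * (x 0 - a)\<^sup>2
      - (\<Sum>i<1. (if i = 0 then L * (x 0 - a) else 0) * (y i - x i))\<bar> \<le> L / 2 * (\<Sum>i<1. (y i - x i)\<^sup>2)"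
  proof -
    have s: "(\<Sum>i<1. (if i = 0 then L * (x 0 - a) else 0) * (y i - x i)) = L * (x 0 - a) * (y 0 - x 0)"
      by simp
    have "L / 2 * (y 0 - a)\<^sup>2 - L / 2 * (x 0 - a)\<^sup>2 - L * (x 0 - a) * (y 0 - x 0)
        = L / 2 * (y 0 - x 0)\<^sup>2"
      by (simp add: power2_eq_square field_simps)
    then show ?thesis unfolding s using L by (simp only:) simp
  qed
  show "edist 1 (\<lambda>i. if i = 0 then L * (x 0 - a) else 0) (\<lambda>i. if i = 0 then L * (y 0 - a) else 0)
      \<le> L * edist 1 x y"
    using L by (simp add: edist_def enorm_def L2_set_def flip: right_diff_distrib) (simp add: abs_mult)
  have "L / 2 * a\<^sup>2 = \<Delta>" using L \<Delta> by (simp add: a_def)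
  then show "L / 2 * (0 - a)\<^sup>2 - \<Delta> \<le> L / 2 * (x 0 - a)\<^sup>2" using L by simp
  fix k assume van: "vanishes_from k x"
  show "\<bar>if k = 0 then L * (x 0 - a) else 0\<bar> \<le> sqrt (2 * \<Delta> * L)"
    using van L \<Delta> a La by (simp add: vanishes_from_def)
  show "\<tau> < enorm 1 (\<lambda>i. if i = 0 then L * (x 0 - a) else 0)" if "k < 1"
    using van that \<tau> L \<Delta> a La by (simp add: vanishes_from_def enorm_def L2_set_def)
qed (use L \<Delta> in auto)

text \<open>The condition \<open>\<epsilon> + B\<^sub>1\<^sup>2 < 2 * \<Delta> * L\<^sub>1\<close>
  excludes the trivial regime: every \<open>F\<close> in the class has gradient norm at most
  \<open>sqrt (2 * \<Delta> * L\<^sub>1)\<close> at 0, which is the first point of a zero-respecting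
  algorithm, so otherwise no query would be needed. The constant depends on the success probability
  \<open>p\<close>.\<close>

theorem theorem1:
  fixes p C :: real
  assumes "0 < p" and "p \<le> 1"
  shows "\<exists>c>0. \<forall>\<Delta> L\<^sub>1 \<sigma>\<^sub>1 \<epsilon> B\<^sub>1 :: real.
    0 < \<Delta> \<longrightarrow> 0 < L\<^sub>1 \<longrightarrow> 0 < \<sigma>\<^sub>1 \<longrightarrow> 0 < \<epsilon> \<longrightarrow> \<epsilon> < 1 / 4 \<longrightarrow> 0 \<le> B\<^sub>1 \<longrightarrow> B\<^sub>1 \<le> C \<longrightarrow>
    \<epsilon> + B\<^sub>1\<^sup>2 < 2 * \<Delta> * L\<^sub>1 \<longrightarrow>
    (\<exists>d. \<exists>F \<in> smooth_class d \<Delta> L\<^sub>1. \<exists>(g, P) \<in> oracle_class d F \<sigma>\<^sub>1 B\<^sub>1.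
      \<forall>(S :: real measure) A.
        algorithm d S A \<longrightarrow> zero_respecting d \<Delta> L\<^sub>1 \<sigma>\<^sub>1 B\<^sub>1 S A \<longrightarrow>
        ereal (c * (\<Delta> * L\<^sub>1 / (\<epsilon> + B\<^sub>1\<^sup>2) + \<Delta> * L\<^sub>1 * \<sigma>\<^sub>1\<^sup>2 / (\<epsilon>\<^sup>2 + B\<^sub>1 ^ 4)))
          \<le> query_complexity d F g (P :: real measure) S A (sqrt (\<epsilon> + B\<^sub>1\<^sup>2)) p)"
\<comment> \<open>\<open>10 ^ 6\<close> exceeds the losses of both cases below; the largest, from
  the quadratic, is \<open>4 * 384 ^ 2\<close>.\<close>
proof (intro exI[of _ "p / 10 ^ 6"] conjI allI impI)
  show "0 < p / 10 ^ 6" using assms by simp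
  fix \<Delta> L \<sigma> \<epsilon> B :: real
  assume \<Delta>: "0 < \<Delta>" and L: "0 < L" and \<sigma>: "0 < \<sigma>" and \<epsilon>: "0 < \<epsilon>" and B: "0 \<le> B"
    and small: "\<epsilon> + B\<^sup>2 < 2 * \<Delta> * L"
  define \<tau> where "\<tau> = sqrt (\<epsilon> + B\<^sup>2)"
  define X s where "X = \<Delta> * L / \<tau>\<^sup>2" and "s = \<sigma>\<^sup>2 / \<tau>\<^sup>2"
  define c where "c = p / 10 ^ 6 * (\<Delta> * L / (\<epsilon> + B\<^sup>2) + \<Delta> * L * \<sigma>\<^sup>2 / (\<epsilon>\<^sup>2 + B ^ 4))"
  have sq: "\<tau>\<^sup>2 = \<epsilon> + B\<^sup>2" using \<epsilon> by (simp add: \<tau>_def add_nonneg_nonneg)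
  have \<tau>: "0 < \<tau>" unfolding \<tau>_def using \<epsilon> by (simp add: add_pos_nonneg)
  have X: "0 < X" using \<Delta> L \<tau> by (simp add: X_def)
  have s: "0 \<le> s" by (simp add: s_def)
  have "\<Delta> * L * \<sigma>\<^sup>2 / (\<epsilon>\<^sup>2 + B ^ 4) \<le> 2 * (X * s)"
  proof -
    \<comment> \<open>Trades the denominator \<open>\<epsilon>\<^sup>2 + B ^ 4\<close> for a power
      of \<open>\<tau>\<close> at the cost of a factor 2; from here on only \<open>X\<close> and
      \<open>s\<close> matter.\<close>
    have "\<tau> ^ 4 \<le> 2 * (\<epsilon>\<^sup>2 + B ^ 4)"
    proof -
      have "\<tau> ^ 4 = (\<epsilon> + B\<^sup>2)\<^sup>2" by (simp flip: sq)
      also have "\<dots> \<le> 2 * (\<epsilon>\<^sup>2 + (B\<^sup>2)\<^sup>2)"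
        using sum_squares_bound[of \<epsilon> "B\<^sup>2"] by (simp add: power2_sum)
      finally show ?thesis by simp
    qed
    moreover have "0 < \<tau> ^ 4" using \<tau> by simp
    ultimately have "\<Delta> * L * \<sigma>\<^sup>2 / (2 * (\<epsilon>\<^sup>2 + B ^ 4)) \<le> \<Delta> * L * \<sigma>\<^sup>2 / \<tau> ^ 4"
      using \<Delta> L by (intro frac_le) simp_all
    also have "\<dots> = X * s" by (simp add: X_def s_def power4_eq_xxxx power2_eq_square)
    finally have *: "\<Delta> * L * \<sigma>\<^sup>2 / (2 * (\<epsilon>\<^sup>2 + B ^ 4)) \<le> X * s" .
    have "u / v \<le> 2 * w" if "u / (2 * v) \<le> w" for u v w :: real
      using that by simp
    from this[OF *] show ?thesis .
  qed
  then have "p * (\<Delta> * L / (\<epsilon> + B\<^sup>2) + \<Delta> * L * \<sigma>\<^sup>2 / (\<epsilon>\<^sup>2 + B ^ 4)) \<le> p * (X + 2 * (X * s))"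
    using assms(1) by (intro mult_left_mono) (auto simp: X_def sq)
  then have c: "c \<le> p * (X + 2 * (X * s)) / 10 ^ 6"
    unfolding c_def by simp
  show "\<exists>d. \<exists>F \<in> smooth_class d \<Delta> L. \<exists>(g, P) \<in> oracle_class d F \<sigma> B.
      \<forall>(S :: real measure) A. algorithm d S A \<longrightarrow> zero_respecting d \<Delta> L \<sigma> B S A \<longrightarrow>
        ereal (p / 10 ^ 6 * (\<Delta> * L / (\<epsilon> + B\<^sup>2) + \<Delta> * L * \<sigma>\<^sup>2 / (\<epsilon>\<^sup>2 + B ^ 4)))
          \<le> query_complexity d F g (P :: real measure) S A (sqrt (\<epsilon> + B\<^sup>2)) p"
  proof (cases "384 \<le> X")
    case True
    define T where "T = nat \<lfloor>X / 384\<rfloor>"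
    have T: "0 < T" "real T \<le> X / 384" "X / 384 < real T + 1"
      using True unfolding T_def by linarith+
    \<comment> \<open>As \<open>T \<ge> 1\<close>, rounding down loses at most a factor 2.\<close>
    have T': "X / 768 \<le> real T" using T(1,3) by linarith
    \<comment> \<open>Solves \<open>a * b / 4 = \<tau>\<close> and
      \<open>a * b\<^sup>2 * 24 = L\<close>. The gap condition \<open>a * T \<le> \<Delta>\<close>
      then reads \<open>T \<le> X / 384\<close>, and the frontier bound becomes
      \<open>12 * \<tau>\<close>.\<close>
    define a b where "a = 384 * \<tau>\<^sup>2 / L" and "b = L / (96 * \<tau>)"
    have ab: "0 < a" "0 < b" using \<tau> L by (simp_all add: a_def b_def)
    have "a * real T \<le> a * (X / 384)" using T(2) ab by (intro mult_left_mono) auto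
    also have "\<dots> = \<Delta>" using \<tau> L by (simp add: a_def X_def)
    finally have gap: "a * real T \<le> \<Delta>" .
    have ab1: "a * b = 4 * \<tau>" using \<tau> L by (simp add: a_def b_def power2_eq_square)
    have "a * b\<^sup>2 = (a * b) * b" by (simp add: power2_eq_square)
    then have ab2: "a * b\<^sup>2 * 24 = L" unfolding ab1 using \<tau> L by (simp add: b_def)
    interpret zero_chain T "\<lambda>x. a * chain T (\<lambda>i. b * x i)"
      "\<lambda>x i. a * b * chain_grad T (\<lambda>i. b * x i) i" "a * b\<^sup>2 * 23" L \<Delta> "12 * \<tau>" \<tau>
      using zero_chain_chain[OF T(1) ab gap] unfolding ab2 ab1 by simp
    have "X + 2 * (X * s) \<le> 10 ^ 6 * (X / 768 * (1 + s / 144))"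
    proof -
      have "0 \<le> X * s" using X s by simp
      then show ?thesis using X by (simp add: field_simps)
    qed
    also have "\<dots> \<le> 10 ^ 6 * (real T * (1 + s / 144))"
      using T' s by (intro mult_left_mono mult_right_mono) auto
    finally have "p * (X + 2 * (X * s)) / 10 ^ 6 \<le> p * (real T * (1 + s / 144))"
      using assms(1) by (simp add: divide_le_eq mult.left_commute)
    also have "s / 144 = \<sigma>\<^sup>2 / (12 * \<tau>)\<^sup>2" by (simp add: s_def power_mult_distrib)
    finally have "c \<le> p * real T * (1 + \<sigma>\<^sup>2 / (12 * \<tau>)\<^sup>2)"
      unfolding mult.assoc by (rule order.trans[OF c])
    note bound = complexity_lower_bound[OF \<sigma> B assms(1) this, unfolded c_def \<tau>_def]
    show ?thesis by (rule exI[of _ T]) (rule bound)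
  next
    case False
    have "\<tau> < sqrt (2 * \<Delta> * L)" using small by (simp add: \<tau>_def)
    then interpret zero_chain 1 "\<lambda>x. L / 2 * (x 0 - sqrt (2 * \<Delta> / L))\<^sup>2"
      "\<lambda>x i. if i = 0 then L * (x 0 - sqrt (2 * \<Delta> / L)) else 0" "L / 2" L \<Delta> "sqrt (2 * \<Delta> * L)" \<tau>
      by (rule zero_chain_quadratic[OF L \<Delta>])
    \<comment> \<open>With \<open>M\<^sup>2 = 2 * \<Delta> * L\<close> a single coordinate yields
      \<open>1 + s / (2 * X)\<close>; boundedness of \<open>X\<close> turns this into a bound of
      order \<open>X + X * s\<close>.\<close>
    have "X * X \<le> 384 * 384" using False X by (intro mult_mono) auto
    then have "X * X * s \<le> 384 * 384 * s" using s by (rule mult_right_mono)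
    also have "X * X * s = X * s * X" by (simp only: mult_ac)
    finally have "X * s \<le> 384 * 384 * s / X" using X by (simp add: pos_le_divide_eq)
    moreover have "0 \<le> s / X" using s X by simp
    ultimately have "X + 2 * (X * s) \<le> 10 ^ 6 * (1 + s / (2 * X))"
      using False by simp
    then have "p * (X + 2 * (X * s)) / 10 ^ 6 \<le> p * (1 + s / (2 * X))"
      using assms(1) by (simp add: divide_le_eq mult.left_commute)
    also have "s / (2 * X) = \<sigma>\<^sup>2 / (sqrt (2 * \<Delta> * L))\<^sup>2"
      using \<Delta> L \<tau> by (simp add: s_def X_def)
    finally have "c \<le> p * real 1 * (1 + \<sigma>\<^sup>2 / (sqrt (2 * \<Delta> * L))\<^sup>2)"
      unfolding of_nat_1 mult_1_right by (rule order.trans[OF c])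
    note bound = complexity_lower_bound[OF \<sigma> B assms(1) this, unfolded c_def \<tau>_def]
    show ?thesis by (rule exI[of _ 1]) (rule bound)
  qed
qed

end
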